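(* Let $K$ be the boundary of a simplicial polytope. If $K$ is flag, then $K$ is almost cohomologically symplectic.
   Context: $K$ is flag if every non-face $I\subseteq V(K)$ (vertex set of $K$) contains a non-face of cardinality two. Almost cohomologically symplectic: let $K$ be the boundary of a simplicial polytope with $m$ vertices labelled by $[m]$. $K$ is almost cohomologically symplectic (almost c-symplectic) if for some $\ell$ there are homogeneous classes $\alpha_1,\dots,\alpha_\ell$ with $\alpha_i\in H^{d_i,\omega_i}(\mathbb{R}\mathcal{Z}_K;\mathbb{Q})$, each $d_i\in\{1,2\}$ and $\omega_i\subseteq[m]$, such that $\alpha_1\smile\dots\smile\alpha_\ell\neq0$ and $\omega_1\triangle\dots\triangle\omega_\ell=[m]$ (symmetric difference). Here $\mathbb{R}\mathcal{Z}_K=\bigcup_{\sigma\in K}\{(x_1,\dots,x_m)\in[0,1]^m: x_i\in\{0,1\}\text{ when }i\notin\sigma\}$, and the grading $H^{p,\omega}$ is as follows. Let $\mathcal{R}$ be the differential graded $\mathbb{Q}$-algebra generated by $u_i$ (degree 1), $t_i$ (degree 0), $1\le i\le m$, with $du_i=0$, $dt_i=u_i$, the graded Leibniz rule, and relations $u_iu_i=0$, $u_it_i=u_i$, $t_iu_i=-u_i$, $t_it_i=1$, and for $i\ne j$: $u_iu_j=-u_ju_i$, $u_it_j=t_ju_i$, $t_it_j=t_jt_i$. For $\sigma=\{i_1<\dots<i_k\}$ put $u_\sigma=u_{i_1}\cdots u_{i_k}$, $t_\sigma=t_{i_1}\cdots t_{i_k}$; $\mathcal{R}^K$ is the quotient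 of $\mathcal{R}$ by the ideal generated by the $u_\sigma$ with $\sigma\notin K$. For $\omega\subseteq[m]$, $\mathcal{R}^K_\omega$ is the subcomplex spanned by $u_\sigma t_{\omega\setminus\sigma}$ with $\sigma\subseteq\omega$, $\sigma\in K$. There is a graded algebra isomorphism $H^*(\mathbb{R}\mathcal{Z}_K;\mathbb{Q})\cong H(\mathcal{R}^K,d)$ (induced from cellular cochains of the cube by $u_i=2\cdot\underline{01}_i^*$, $t_i=1_i^*-0_i^*$, where $0_i^*,1_i^*,\underline{01}_i^*$ are dual to the cells of the $i$th interval), and $H^{p,\omega}(\mathbb{R}\mathcal{Z}_K;\mathbb{Q})$ is the summand corresponding to $H^p(\mathcal{R}^K_\omega,d)$. A class is homogeneous if it lies in some $H^{p,\omega}$. *)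

theory Defs
  imports
    "HOL-Analysis.Analysis"
    "HOL-Homology.Homology"
    "HOL-Combinatorics.Multiset_Permutations"
begin

text \<open>Throughout, the label set \<open>[m]\<close> is \<open>{..<m}\<close>, so that coordinates of \<open>\<real>\<^sup>m\<close> match those of
  \<^const>\<open>Euclidean_space\<close>, whose points are functions \<open>nat \<Rightarrow> real\<close> vanishing from \<open>m\<close> on.\<close>

section \<open>Boundary complexes of simplicial polytopes\<close>

definition simplicial_polytope :: "'a::euclidean_space set \<Rightarrow> bool" where
  "simplicial_polytope P \<longleftrightarrow>
     polytope P \<and> (\<forall>F. F face_of P \<and> F \<noteq> P \<longrightarrow> (\<exists>n. n simplex F))"

text \<open>\<open>v\<close> labels the vertices of \<open>P\<close>; the empty set is a face.\<close>

definition boundary_complex :: "nat \<Rightarrow> (nat \<Rightarrow> 'a::euclidean_space) \<Rightarrow> 'a set \<Rightarrow> nat set set" where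
  "boundary_complex m v P =
     {\<sigma>. \<sigma> \<subseteq> {..<m} \<and> convex hull (v ` \<sigma>) face_of P \<and> convex hull (v ` \<sigma>) \<noteq> P}"

definition flag_complex :: "nat set set \<Rightarrow> bool" where
  "flag_complex K \<longleftrightarrow> (\<forall>I. I \<subseteq> \<Union>K \<and> I \<notin> K \<longrightarrow> (\<exists>J\<subseteq>I. J \<notin> K \<and> card J = 2))"

section \<open>Singular cohomology with rational coefficients\<close>

text \<open>A \<open>p\<close>-cochain of \<open>X\<close> is a rational function on the singular \<open>p\<close>-simplices of \<open>X\<close>, extended by zero.\<close>

type_synonym 'a cochain = "((nat \<Rightarrow> real) \<Rightarrow> 'a) \<Rightarrow> rat"

definition cochains :: "nat \<Rightarrow> 'a topology \<Rightarrow> 'a cochain set" where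
  "cochains p X = {a. \<forall>f. \<not> singular_simplex p X f \<longrightarrow> a f = 0}"

definition coboundary :: "nat \<Rightarrow> 'a topology \<Rightarrow> 'a cochain \<Rightarrow> 'a cochain" where
  "coboundary p X a = (\<lambda>f. if singular_simplex (Suc p) X f
     then \<Sum>k\<le>Suc p. (-1) ^ k * a (singular_face (Suc p) k f) else 0)"

definition cocycles :: "nat \<Rightarrow> 'a topology \<Rightarrow> 'a cochain set" where
  "cocycles p X = {a \<in> cochains p X. coboundary p X a = (\<lambda>_. 0)}"

definition coboundaries :: "nat \<Rightarrow> 'a topology \<Rightarrow> 'a cochain set" where
  "coboundaries p X =
     (case p of 0 \<Rightarrow> {\<lambda>_. 0} | Suc q \<Rightarrow> coboundary q X ` cochains q X)"

definition cohomologous :: "nat \<Rightarrow> 'a topology \<Rightarrow> ('a cochain \<times> 'a cochain) set" where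
  "cohomologous p X = {(a, b). a \<in> cocycles p X \<and> b \<in> cocycles p X \<and>
     (\<lambda>f. a f - b f) \<in> coboundaries p X}"

definition cohomology :: "nat \<Rightarrow> 'a topology \<Rightarrow> 'a cochain set set" where
  "cohomology p X = cocycles p X // cohomologous p X"

definition front_face :: "nat \<Rightarrow> ((nat \<Rightarrow> real) \<Rightarrow> 'a) \<Rightarrow> (nat \<Rightarrow> real) \<Rightarrow> 'a" where
  "front_face p f = restrict f (standard_simplex p)"

definition back_face :: "nat \<Rightarrow> nat \<Rightarrow> ((nat \<Rightarrow> real) \<Rightarrow> 'a) \<Rightarrow> (nat \<Rightarrow> real) \<Rightarrow> 'a" where
  "back_face p q f =
     restrict (\<lambda>x. f (\<lambda>i. if i < p then 0 else x (i - p))) (standard_simplex q)"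

definition cochain_cup ::
    "nat \<Rightarrow> nat \<Rightarrow> 'a topology \<Rightarrow> 'a cochain \<Rightarrow> 'a cochain \<Rightarrow> 'a cochain" where
  "cochain_cup p q X a b = (\<lambda>f. if singular_simplex (p + q) X f
     then a (front_face p f) * b (back_face p q f) else 0)"

definition zero_class :: "nat \<Rightarrow> 'a topology \<Rightarrow> 'a cochain set" where
  "zero_class p X = cohomologous p X `` {\<lambda>_. 0}"

definition unit_class :: "'a topology \<Rightarrow> 'a cochain set" where
  "unit_class X = cohomologous 0 X `` {\<lambda>f. if singular_simplex 0 X f then 1 else 0}"

definition cup :: "nat \<Rightarrow> nat \<Rightarrow> 'a topology \<Rightarrow> 'a cochain set \<Rightarrow> 'a cochain set \<Rightarrow> 'a cochain set" where
  "cup p q X A B = (\<Union>a\<in>A. \<Union>b\<in>B. cohomologous (p + q) X `` {cochain_cup p q X a b})"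

text \<open>The list entries are classes paired with their degrees.\<close>

fun cup_list :: "'a topology \<Rightarrow> (nat \<times> 'a cochain set) list \<Rightarrow> 'a cochain set" where
  "cup_list X [] = unit_class X"
| "cup_list X ((d, A) # xs) = cup d (sum_list (map fst xs)) X A (cup_list X xs)"

section \<open>The real moment-angle complex and its cellular cochains\<close>

definition real_moment_angle :: "nat \<Rightarrow> nat set set \<Rightarrow> (nat \<Rightarrow> real) topology" where
  "real_moment_angle m K = subtopology (Euclidean_space m)
     (\<Union>\<sigma>\<in>K. {x. (\<forall>i<m. 0 \<le> x i \<and> x i \<le> 1) \<and> (\<forall>i<m. i \<notin> \<sigma> \<longrightarrow> x i \<in> {0, 1})})"

datatype interval_cell = Lo | Hi | Edge

text \<open>A cell of the cube \<open>[0,1]\<^sup>m\<close> is a function \<open>e\<close> choosing \<open>0\<close>, \<open>1\<close> or \<open>01\<close> in each factor, set to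
  \<^const>\<open>Lo\<close> from \<open>m\<close> on.  It is oriented by the increasing order on \<open>dirs e\<close>.\<close>

definition dirs :: "(nat \<Rightarrow> interval_cell) \<Rightarrow> nat set" where
  "dirs e = {i. e i = Edge}"

definition cells :: "nat \<Rightarrow> nat set set \<Rightarrow> nat \<Rightarrow> (nat \<Rightarrow> interval_cell) set" where
  "cells m K p = {e. (\<forall>i\<ge>m. e i = Lo) \<and> dirs e \<in> K \<and> card (dirs e) = p}"

type_synonym cell_cochain = "(nat \<Rightarrow> interval_cell) \<Rightarrow> rat"

definition cell_coboundary :: "cell_cochain \<Rightarrow> cell_cochain" where
  "cell_coboundary a = (\<lambda>e. \<Sum>i\<in>dirs e. (-1) ^ card {j \<in> dirs e. j < i} *
     (a (e(i := Hi)) - a (e(i := Lo))))"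

text \<open>The cup product of the cube is the tensor power of that of the interval, where
  \<open>0\<^sup>* 0\<^sup>* = 0\<^sup>*\<close>, \<open>1\<^sup>* 1\<^sup>* = 1\<^sup>*\<close>, \<open>0\<^sup>* 01\<^sup>* = 01\<^sup>* = 01\<^sup>* 1\<^sup>*\<close> and all other products of
  dual cells vanish; the sign is the Koszul sign.\<close>

definition cell_cup :: "cell_cochain \<Rightarrow> cell_cochain \<Rightarrow> cell_cochain" where
  "cell_cup a b = (\<lambda>e. \<Sum>H\<in>Pow (dirs e).
     (-1) ^ card {(h, k). h \<in> H \<and> k \<in> dirs e - H \<and> k < h} *
     a (\<lambda>i. if i \<in> dirs e - H then Lo else e i) *
     b (\<lambda>i. if i \<in> H then Hi else e i))"

definition cell_unit :: cell_cochain where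
  "cell_unit = (\<lambda>e. if dirs e = {} then 1 else 0)"

text \<open>\<open>u_gen i\<close> and \<open>t_gen i\<close> are the pullbacks of \<open>2 \<cdot> 01\<^sup>*\<close> and \<open>1\<^sup>* - 0\<^sup>*\<close> from the \<open>i\<close>th factor.\<close>

definition u_gen :: "nat \<Rightarrow> cell_cochain" where
  "u_gen i = (\<lambda>e. if dirs e = {i} then 2 else 0)"

definition t_gen :: "nat \<Rightarrow> cell_cochain" where
  "t_gen i = (\<lambda>e. if dirs e = {} then (if e i = Hi then 1 else -1) else 0)"

lemma cell_cup_supp:
  assumes a: "\<forall>e. dirs e \<noteq> A \<longrightarrow> a e = 0" and b: "\<forall>e. dirs e \<noteq> B \<longrightarrow> b e = 0"
    and fin: "finite A" "finite B"
  shows "cell_cup a b e = (if dirs e = A \<union> B \<and> A \<inter> B = {} then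
     (-1) ^ card {(h, k). h \<in> A \<and> k \<in> B \<and> k < h} *
     a (\<lambda>i. if i \<in> B then Lo else e i) * b (\<lambda>i. if i \<in> A then Hi else e i) else 0)"
proof -
  let ?f = "\<lambda>H. (-1) ^ card {(h, k). h \<in> H \<and> k \<in> dirs e - H \<and> k < h} *
     a (\<lambda>i. if i \<in> dirs e - H then Lo else e i) * b (\<lambda>i. if i \<in> H then Hi else e i)"
  have d1: "dirs (\<lambda>i. if i \<in> dirs e - H then Lo else e i) = H" if "H \<subseteq> dirs e" for H
    using that by (auto simp: dirs_def)
  have d2: "dirs (\<lambda>i. if i \<in> H then Hi else e i) = dirs e - H" for H
    by (auto simp: dirs_def)
  have z: "?f H = 0" if "H \<subseteq> dirs e" "H \<noteq> A \<or> dirs e - H \<noteq> B" for H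
    using that a[rule_format, of "\<lambda>i. if i \<in> dirs e - H then Lo else e i"]
      b[rule_format, of "\<lambda>i. if i \<in> H then Hi else e i"] d1[of H] d2[of H] by auto
  show ?thesis
  proof (cases "dirs e = A \<union> B \<and> A \<inter> B = {}")
    case True
    then have AB: "dirs e - A = B" "A \<subseteq> dirs e" by auto
    have "cell_cup a b e = sum ?f {A}"
      unfolding cell_cup_def
      by (rule sum.mono_neutral_right) (use True fin z AB in auto)
    also have "\<dots> = ?f A" by simp
    finally show ?thesis unfolding AB(1) using True by simp
  next
    case False
    then have "\<And>H. H \<subseteq> dirs e \<Longrightarrow> ?f H = 0" using z by blast
    then have "cell_cup a b e = 0" unfolding cell_cup_def by (intro sum.neutral) auto
    then show ?thesis by (simp only: False if_False)
  qed
qed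

text \<open>These are the defining relations of the differential graded algebra \<open>\<R>\<close>, so that \<open>\<R>\<close> is
  realised as the algebra of cellular cochains of the cube.\<close>

lemma gen_relations:
  shows "cell_cup (u_gen i) (u_gen i) = (\<lambda>_. 0)"
    and "cell_cup (u_gen i) (t_gen i) = u_gen i"
    and "cell_cup (t_gen i) (u_gen i) = (\<lambda>e. - u_gen i e)"
    and "cell_cup (t_gen i) (t_gen i) = cell_unit"
    and "i \<noteq> j \<Longrightarrow> cell_cup (u_gen i) (u_gen j) = (\<lambda>e. - cell_cup (u_gen j) (u_gen i) e)"
    and "i \<noteq> j \<Longrightarrow> cell_cup (u_gen i) (t_gen j) = cell_cup (t_gen j) (u_gen i)"
    and "i \<noteq> j \<Longrightarrow> cell_cup (t_gen i) (t_gen j) = cell_cup (t_gen j) (t_gen i)"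
    and "cell_coboundary (u_gen i) = (\<lambda>_. 0)"
    and "cell_coboundary (t_gen i) = u_gen i"
proof -
  have su: "\<forall>e. dirs e \<noteq> {k} \<longrightarrow> u_gen k e = 0" for k by (simp add: u_gen_def)
  have st: "\<forall>e. dirs e \<noteq> {} \<longrightarrow> t_gen k e = 0" for k by (simp add: t_gen_def)
  have dm: "dirs (\<lambda>x. if x = k then Lo else e x) = dirs e - {k}"
      "dirs (\<lambda>x. if x = k then Hi else e x) = dirs e - {k}" for e k
    by (auto simp: dirs_def)
  have uu: "cell_cup (u_gen i) (u_gen j) e =
      (if dirs e = {i, j} \<and> i \<noteq> j then (if j < i then - 4 else 4) else 0)" for i j e
  proof -
    have c: "{(h, k). h \<in> {i} \<and> k \<in> {j} \<and> k < h} = (if j < i then {(i, j)} else {})" by auto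
    have s: "{i} \<union> {j} = {i, j}" "({i} \<inter> {j} = {}) = (i \<noteq> j)" by auto
    have d: "{i, j} - {j} = {i}" "{i, j} - {i} = {j}" if "i \<noteq> j" using that by auto
    show ?thesis
      unfolding cell_cup_supp[where a="u_gen i" and A="{i}" and b="u_gen j" and B="{j}", OF su su finite.insertI[OF finite.emptyI] finite.insertI[OF finite.emptyI]] c s
      by (cases "dirs e = {i, j} \<and> i \<noteq> j") (simp_all add: u_gen_def dm d)
  qed
  have ut: "cell_cup (u_gen i) (t_gen j) e =
      (if dirs e = {i} then (if i = j \<or> e j = Hi then 2 else - 2) else 0)" for i j e
    unfolding cell_cup_supp[where a="u_gen i" and A="{i}" and b="t_gen j" and B="{}", OF su st finite.insertI[OF finite.emptyI] finite.emptyI]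
    by (cases "dirs e = {i}") (simp_all add: u_gen_def t_gen_def dm)
  have tu: "cell_cup (t_gen j) (u_gen i) e =
      (if dirs e = {i} then (if i \<noteq> j \<and> e j = Hi then 2 else - 2) else 0)" for i j e
    unfolding cell_cup_supp[where a="t_gen j" and A="{}" and b="u_gen i" and B="{i}", OF st su finite.emptyI finite.insertI[OF finite.emptyI]]
    by (cases "dirs e = {i}") (simp_all add: u_gen_def t_gen_def dm)
  have tt: "cell_cup (t_gen i) (t_gen j) e =
      (if dirs e = {} then (if (e i = Hi) = (e j = Hi) then 1 else - 1) else 0)" for i j e
    unfolding cell_cup_supp[where a="t_gen i" and A="{}" and b="t_gen j" and B="{}", OF st st finite.emptyI finite.emptyI]
    by (cases "dirs e = {}") (simp_all add: t_gen_def)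
  show "cell_cup (u_gen i) (u_gen i) = (\<lambda>_. 0)" by (simp add: uu fun_eq_iff)
  show "cell_cup (u_gen i) (t_gen i) = u_gen i" by (rule ext) (simp only: ut, simp add: u_gen_def)
  show "cell_cup (t_gen i) (u_gen i) = (\<lambda>e. - u_gen i e)" by (rule ext) (simp only: tu, simp add: u_gen_def)
  show "cell_cup (t_gen i) (t_gen i) = cell_unit" by (rule ext) (simp only: tt, simp add: cell_unit_def)
  show "cell_cup (u_gen i) (u_gen j) = (\<lambda>e. - cell_cup (u_gen j) (u_gen i) e)" if "i \<noteq> j"
    by (rule ext) (use that in \<open>simp add: uu insert_commute[of j i]\<close>)
  show "cell_cup (u_gen i) (t_gen j) = cell_cup (t_gen j) (u_gen i)" if "i \<noteq> j"
    by (rule ext) (use that in \<open>simp add: ut tu\<close>)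
  show "cell_cup (t_gen i) (t_gen j) = cell_cup (t_gen j) (t_gen i)"
    by (rule ext) (simp add: tt eq_commute)
  have upd: "dirs (e(k := Hi)) = dirs e - {k}" "dirs (e(k := Lo)) = dirs e - {k}" for e k
    by (auto simp: dirs_def)
  show "cell_coboundary (u_gen i) = (\<lambda>_. 0)"
    by (simp add: cell_coboundary_def u_gen_def upd)
  show "cell_coboundary (t_gen i) = u_gen i"
  proof
    fix e
    let ?g = "\<lambda>k. (-1) ^ card {j \<in> dirs e. j < k} * (t_gen i (e(k := Hi)) - t_gen i (e(k := Lo)))"
    have g: "?g k = (if k = i \<and> dirs e = {i} then 2 else 0)" if "k \<in> dirs e" for k
    proof (cases "k = i \<and> dirs e = {i}")
      case True
      then have "{j \<in> dirs e. j < k} = {}" by auto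
      then show ?thesis using True by (simp only: t_gen_def upd) simp
    next
      case False
      have "t_gen i (e(k := Hi)) = t_gen i (e(k := Lo))"
      proof (cases "dirs e - {k} = {}")
        case True
        then have "dirs e = {k}" using that by blast
        then have "i \<noteq> k" using False by blast
        then show ?thesis by (simp add: t_gen_def upd)
      qed (simp add: t_gen_def upd)
      then show ?thesis using False by (simp only: if_False) simp
    qed
    have "cell_coboundary (t_gen i) e = (\<Sum>k\<in>dirs e. if k = i \<and> dirs e = {i} then 2 else 0)"
      unfolding cell_coboundary_def by (rule sum.cong[OF refl g])
    then show "cell_coboundary (t_gen i) e = u_gen i e"
      by (cases "dirs e = {i}") (simp_all add: u_gen_def)
  qed
qed

definition u_mon :: "nat set \<Rightarrow> cell_cochain" where
  "u_mon \<sigma> = foldr cell_cup (map u_gen (sorted_list_of_set \<sigma>)) cell_unit"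

definition t_mon :: "nat set \<Rightarrow> cell_cochain" where
  "t_mon \<tau> = foldr cell_cup (map t_gen (sorted_list_of_set \<tau>)) cell_unit"

text \<open>The degree \<open>p\<close> part of the complex \<open>\<R>\<^sup>K\<^sub>\<omega>\<close>, with \<open>\<R>\<^sup>K\<close> identified with the cellular cochains of
  the real moment-angle complex.  The differential is \<^const>\<open>cell_coboundary\<close>.  Passing to the
  quotient \<open>\<R>\<^sup>K\<close> of \<open>\<R>\<close> means evaluating on \<^term>\<open>cells m K p\<close> only.\<close>

definition RK :: "nat set set \<Rightarrow> nat set \<Rightarrow> nat \<Rightarrow> cell_cochain set" where
  "RK K \<omega> p = {\<lambda>e. \<Sum>\<sigma>\<in>{\<sigma>\<in>K. \<sigma> \<subseteq> \<omega> \<and> card \<sigma> = p}. c \<sigma> * cell_cup (u_mon \<sigma>) (t_mon (\<omega> - \<sigma>)) e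
                 | c. True}"

definition RK_cocycles :: "nat \<Rightarrow> nat set set \<Rightarrow> nat set \<Rightarrow> nat \<Rightarrow> cell_cochain set" where
  "RK_cocycles m K \<omega> p = {z \<in> RK K \<omega> p. \<forall>e\<in>cells m K (Suc p). cell_coboundary z e = 0}"

section \<open>The grading on the cohomology of the real moment-angle complex\<close>

text \<open>An ordering \<open>xs\<close> of \<open>dirs e\<close> determines a simplex of the standard triangulation of the closed
  cell \<open>e\<close>, with \<open>j\<close>th vertex \<open>cell_vertex e xs j\<close>.  Its orientation agrees with that of \<open>e\<close> up to
  the sign of \<open>xs\<close>.\<close>

definition cell_vertex :: "(nat \<Rightarrow> interval_cell) \<Rightarrow> nat list \<Rightarrow> nat \<Rightarrow> nat \<Rightarrow> real" where
  "cell_vertex e xs j =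
     (\<lambda>i. case e i of Lo \<Rightarrow> 0 | Hi \<Rightarrow> 1 | Edge \<Rightarrow> if i \<in> set (take j xs) then 1 else 0)"

definition list_sign :: "nat list \<Rightarrow> rat" where
  "list_sign xs = (-1) ^ card {(i, j). i < j \<and> j < length xs \<and> xs ! j < xs ! i}"

text \<open>Evaluation of singular cochains on triangulated cells.  This is a map of differential graded
  algebras from singular to cellular cochains, and it induces the canonical isomorphism in cohomology.\<close>

definition to_cellular :: "(nat \<Rightarrow> real) cochain \<Rightarrow> cell_cochain" where
  "to_cellular a = (\<lambda>e. \<Sum>xs\<in>permutations_of_set (dirs e).
     list_sign xs * a (oriented_simplex (card (dirs e)) (cell_vertex e xs)))"

definition cell_cohomologous ::
    "nat \<Rightarrow> nat set set \<Rightarrow> nat \<Rightarrow> cell_cochain \<Rightarrow> cell_cochain \<Rightarrow> bool" where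
  "cell_cohomologous m K p a b \<longleftrightarrow>
     (\<exists>w. \<forall>e\<in>cells m K p. a e - b e = cell_coboundary w e)"

text \<open>The summand \<open>H\<^sup>p\<^sup>,\<^sup>\<omega>\<close>: the classes corresponding to classes of cocycles of \<open>\<R>\<^sup>K\<^sub>\<omega>\<close>.\<close>

definition graded_cohomology ::
    "nat \<Rightarrow> nat set set \<Rightarrow> nat \<Rightarrow> nat set \<Rightarrow> (nat \<Rightarrow> real) cochain set set" where
  "graded_cohomology m K p \<omega> = {A \<in> cohomology p (real_moment_angle m K).
     \<exists>z\<in>RK_cocycles m K \<omega> p. \<forall>a\<in>A. cell_cohomologous m K p (to_cellular a) z}"

section \<open>Almost cohomologically symplectic complexes\<close>

text \<open>The list \<open>xs\<close> consists of triples \<open>(d\<^sub>i, \<omega>\<^sub>i, \<alpha>\<^sub>i)\<close>.\<close>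

definition almost_c_symplectic :: "nat \<Rightarrow> nat set set \<Rightarrow> bool" where
  "almost_c_symplectic m K \<longleftrightarrow>
     (\<exists>xs :: (nat \<times> nat set \<times> (nat \<Rightarrow> real) cochain set) list.
        (\<forall>(d, \<omega>, A) \<in> set xs. d \<in> {1, 2} \<and> \<omega> \<subseteq> {..<m} \<and> A \<in> graded_cohomology m K d \<omega>) \<and>
        cup_list (real_moment_angle m K) (map (\<lambda>(d, \<omega>, A). (d, A)) xs)
          \<noteq> zero_class (sum_list (map fst xs)) (real_moment_angle m K) \<and>
        foldr sym_diff (map (\<lambda>(d, \<omega>, A). \<omega>) xs) {} = {..<m})"

end

theory Submission
  imports Defs
begin

text \<open>
  Let \<open>K\<close> be flag of dimension \<open>n - 1\<close> and \<open>\<sigma>\<close> one of its facets.  A vertex \<open>j\<close> outside \<open>\<sigma>\<close> fails to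
  be joined to some \<open>k \<in> \<sigma>\<close>: otherwise flagness would make \<open>\<sigma> \<union> {j}\<close> a face, which is too large.
  Choose such a \<open>k\<close> and call it \<open>g j\<close>, and put \<open>g k = k\<close> on \<open>\<sigma>\<close>.  The fibres \<open>\<omega>\<^sub>k = {k} \<union> B\<^sub>k\<close> of \<open>g\<close>
  partition the vertex set, and \<open>k\<close> is an isolated point of the full subcomplex on \<open>\<omega>\<^sub>k\<close>.  Sending
  \<open>k\<close> to one pole and \<open>B\<^sub>k\<close> to the opposite pole defines a simplicial map from \<open>K\<close> to the boundary of
  the \<open>n\<close>-dimensional cross-polytope under which the facet of first poles has \<open>\<sigma>\<close> as its only preimage.  The
  degree of this map is therefore \<open>\<plusminus>1\<close>, and the product of the \<open>n\<close> degree-one classes that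
  it pulls back is nonzero.

  The class attached to \<open>k\<close> is represented in \<open>\<R>\<^sup>K\<close> by \<open>u\<^sub>k t\<^bsub>B\<^sub>k\<^esub>\<close>.  On the space it is the pullback
  of a generator of the first cohomology of the punctured plane under
  \<open>x \<mapsto> \<Prod>\<^bsub>i \<in> B\<^sub>k\<^esub> (2 x\<^sub>i - 1) + (2 x\<^sub>k - 1) \<i>\<close>, and counting how often a path crosses the positive real
  axis gives an explicit singular cocycle (\<open>crossing_cochain_cocycle\<close>, \<open>loop_class_graded\<close>).

  The product is detected by a top-dimensional cycle.  For a polytope \<open>P\<close> with relative interior point
  \<open>p\<close>, the signs of the determinants of the vectors \<open>v\<^sub>i - p\<close>, \<open>i \<in> \<tau>\<close>, orient the facets \<open>\<tau>\<close>; the two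
  facets at a ridge lie on opposite sides of it, so these signs form a simplicial cycle
  (\<open>fundamental_cycle\<close>).  Multiplied by the signs of the fixed coordinates it becomes
  a cellular cycle of the real moment-angle complex (\<open>cell_cycle_coboundary\<close>).  Triangulating
  cells turns singular coboundaries into cellular ones (\<open>to_cellular_coboundary\<close>), so it remains to
  evaluate the product of the explicit cocycles.  That product vanishes on every simplex of the triangulated
  cells except those that run along the directions of \<open>\<sigma>\<close> in increasing order, and the surviving
  terms all have the same sign.
\<close>

section \<open>Minors of a vector configuration\<close>

text \<open>The determinant with rows \<open>f\<^sub>k\<^sub>-\<^sub>1, \<dots>, f\<^sub>0\<close> and with columns the points \<open>x\<^sub>j\<close>, \<open>j \<in> S\<close>, in increasing
  order, defined by Laplace expansion along the first row.\<close>

primrec minor :: "(nat \<Rightarrow> 'a \<Rightarrow> real) \<Rightarrow> (nat \<Rightarrow> 'a) \<Rightarrow> nat \<Rightarrow> nat set \<Rightarrow> real" where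
  "minor f x 0 S = (if S = {} then 1 else 0)"
| "minor f x (Suc k) S =
     (\<Sum>j\<in>S. (-1) ^ card {i \<in> S. i < j} * f k (x j) * minor f x k (S - {j}))"

lemma card_below_insert:
  fixes i j :: nat
  assumes "finite S" "i \<notin> S"
  shows "card {l \<in> insert i S. l < j} = card {l \<in> S. l < j} + (if i < j then 1 else 0)"
proof -
  have "{l \<in> insert i S. l < j} = (if i < j then insert i {l \<in> S. l < j} else {l \<in> S. l < j})"
    by auto
  then show ?thesis using assms by simp
qed

lemma card_below_remove:
  fixes i j :: nat
  assumes "finite S" "i \<in> S"
  shows "card {l \<in> S. l < j} = card {l \<in> S - {i}. l < j} + (if i < j then 1 else 0)"
  using card_below_insert[of "S - {i}" i j] assms by (simp add: insert_absorb)

text \<open>The sign with which two columns anticommute.\<close>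

lemma sign_insert_remove:
  fixes i j :: nat
  assumes "finite S" "i \<notin> S" "j \<in> S"
  shows "(-1::'b::comm_ring_1) ^ card {l \<in> insert i S. l < j} * (-1) ^ card {l \<in> S - {j}. l < i}
       = - ((-1) ^ card {l \<in> S. l < i} * (-1) ^ card {l \<in> S. l < j})"
proof -
  have "i \<noteq> j" using assms by auto
  then show ?thesis
    unfolding card_below_insert[OF assms(1,2)] card_below_remove[OF assms(1,3), of i]
    by (cases "i < j") simp_all
qed

text \<open>A determinant is a linear function \<open>L\<close> of any one of its columns and vanishes when that column
  repeats another.  The point is that the same \<open>L\<close> serves all \<open>i\<close>, once the sign for moving
  column \<open>i\<close> to the front is split off; this compares the orientations of all facets containing \<open>S\<close>.\<close>

lemma minor_insert:
  fixes f :: "nat \<Rightarrow> 'a::real_vector \<Rightarrow> real"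
  assumes f: "\<And>k. linear (f k)" and S: "finite S" "card S = k"
  shows "\<exists>L. linear L \<and> (\<forall>j\<in>S. L (x j) = (0::real)) \<and>
    (\<forall>i. i \<notin> S \<longrightarrow> minor f x (Suc k) (insert i S) = (-1) ^ card {j \<in> S. j < i} * L (x i))"
  using S
proof (induction k arbitrary: S)
  case 0
  have empty: "{j. j = i \<and> j < i} = {}" for i :: nat by auto
  show ?case using 0 f by (intro exI[of _ "f 0"]) (simp add: empty)
next
  case (Suc k)
  have "\<forall>j\<in>S. \<exists>L. linear L \<and> (\<forall>l\<in>S-{j}. L (x l) = (0::real)) \<and>
    (\<forall>i. i \<notin> S - {j} \<longrightarrow>
      minor f x (Suc k) (insert i (S - {j})) = (-1) ^ card {l \<in> S - {j}. l < i} * L (x i))"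
    by (intro ballI Suc.IH) (use Suc.prems in auto)
  then obtain M where M: "\<And>j. j \<in> S \<Longrightarrow> linear (M j)"
    "\<And>j l. j \<in> S \<Longrightarrow> l \<in> S - {j} \<Longrightarrow> M j (x l) = 0"
    "\<And>j i. j \<in> S \<Longrightarrow> i \<notin> S - {j} \<Longrightarrow>
      minor f x (Suc k) (insert i (S - {j})) = (-1) ^ card {l \<in> S - {j}. l < i} * M j (x i)"
    unfolding bchoice_iff by blast
  let ?s = "\<lambda>j. (-1::real) ^ card {l \<in> S. l < j}"
  define L where "L = (\<lambda>y. f (Suc k) y * minor f x (Suc k) S
    - (\<Sum>j\<in>S. ?s j * f (Suc k) (x j) * M j y))"
  have "linear L"
    unfolding L_def mult.commute[of _ "minor f x (Suc k) S"]
    by (intro linear_compose_sub linear_compose_sum ballI linear_compose_scale_right[where 'b=real, simplified] f M(1))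
  moreover have "L (x l) = 0" if l: "l \<in> S" for l
  proof -
    have "(\<Sum>j\<in>S. ?s j * f (Suc k) (x j) * M j (x l)) = ?s l * f (Suc k) (x l) * M l (x l)"
      using M(2) l Suc.prems(1) by (subst sum.remove[OF _ l]) (auto intro!: sum.neutral)
    moreover have "minor f x (Suc k) S = ?s l * M l (x l)"
      using M(3)[OF l, of l] l card_below_remove[OF Suc.prems(1) l, of l]
      by (simp add: insert_absorb)
    ultimately show ?thesis unfolding L_def by simp
  qed
  moreover have "minor f x (Suc (Suc k)) (insert i S) = ?s i * L (x i)" if i: "i \<notin> S" for i
  proof -
    have e: "insert i S - {j} = insert i (S - {j})" if "j \<in> S" for j using that i by auto
    have "minor f x (Suc (Suc k)) (insert i S)
        = ?s i * f (Suc k) (x i) * minor f x (Suc k) S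
        + (\<Sum>j\<in>S. (-1) ^ card {l \<in> insert i S. l < j} * f (Suc k) (x j)
             * minor f x (Suc k) (insert i S - {j}))"
      using i Suc.prems(1) card_below_insert[OF Suc.prems(1) i, of i]
      by (subst minor.simps, subst sum.insert) (simp_all del: minor.simps)
    also have "(\<Sum>j\<in>S. (-1) ^ card {l \<in> insert i S. l < j} * f (Suc k) (x j)
             * minor f x (Suc k) (insert i S - {j}))
        = (\<Sum>j\<in>S. - ?s i * (?s j * f (Suc k) (x j) * M j (x i)))"
    proof (rule sum.cong[OF refl])
      fix j assume j: "j \<in> S"
      show "(-1) ^ card {l \<in> insert i S. l < j} * f (Suc k) (x j) * minor f x (Suc k) (insert i S - {j})
        = - ?s i * (?s j * f (Suc k) (x j) * M j (x i))"
      proof -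
        have m: "minor f x (Suc k) (insert i S - {j}) = (-1) ^ card {l \<in> S - {j}. l < i} * M j (x i)"
          unfolding e[OF j] using M(3)[OF j, of i] i by blast
        have "(-1) ^ card {l \<in> insert i S. l < j} * f (Suc k) (x j) * minor f x (Suc k) (insert i S - {j})
          = ((-1) ^ card {l \<in> insert i S. l < j} * (-1) ^ card {l \<in> S - {j}. l < i})
            * (f (Suc k) (x j) * M j (x i))"
          unfolding m by (simp only: mult_ac)
        then show ?thesis
          unfolding sign_insert_remove[OF Suc.prems(1) i j] by (simp only: mult_ac minus_mult_left minus_mult_right)
      qed
    qed
    also have "\<dots> = - ?s i * (\<Sum>j\<in>S. ?s j * f (Suc k) (x j) * M j (x i))"
      by (rule sum_distrib_left[symmetric])
    finally show ?thesis unfolding L_def by (simp only: algebra_simps)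
  qed
  ultimately show ?case by blast
qed

lemma minor_dual_basis_nonzero:
  fixes f :: "nat \<Rightarrow> 'a \<Rightarrow> real"
  assumes g: "inj_on g {..<n}"
    and dual: "\<And>k l. k < n \<Longrightarrow> l < n \<Longrightarrow> f k (x (g l)) = (if k = l then 1 else 0)"
  shows "minor f x n (g ` {..<n}) \<noteq> 0"
proof -
  have "k \<le> n \<Longrightarrow> minor f x k (g ` {..<k}) \<noteq> 0" for k
  proof (induction k)
    case (Suc k)
    let ?S = "g ` {..<Suc k}"
    have gk: "g k \<in> ?S" by auto
    have rm: "?S - {g k} = g ` {..<k}"
    proof -
      have "{..<Suc k} - {k} = {..<k}" by auto
      then show ?thesis
        using inj_on_image_set_diff[OF g, of "{..<Suc k}" "{k}"] Suc.prems by auto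
    qed
    have z: "f k (x j) = 0" if "j \<in> ?S - {g k}" for j
      using that rm dual[of k] Suc.prems by auto
    have "minor f x (Suc k) ?S = (-1) ^ card {i \<in> ?S. i < g k} * f k (x (g k)) * minor f x k (?S - {g k})"
      using gk z unfolding minor.simps by (subst sum.remove[OF _ gk]) (auto intro!: sum.neutral)
    then show ?case using Suc dual[of k k] rm by simp
  qed simp
  then show ?thesis by blast
qed

section \<open>Boundary complexes of simplicial polytopes\<close>

locale labelled_simplicial_polytope =
  fixes P :: "'a::euclidean_space set" and v :: "nat \<Rightarrow> 'a" and m n :: nat
  assumes simplicial: "simplicial_polytope P"
    and aff_dim_eq: "aff_dim P = int n" and dim_pos: "1 \<le> n"
    and labels: "bij_betw v {..<m} {x. x extreme_point_of P}"
begin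

abbreviation "K \<equiv> boundary_complex m v P"

lemma polytope: "polytope P"
  using simplicial by (simp add: simplicial_polytope_def)

lemma inj_labels: "inj_on v {..<m}"
  using labels by (simp add: bij_betw_def)

lemma extreme_points_eq: "{x. x extreme_point_of P} = v ` {..<m}"
  using labels by (simp add: bij_betw_def)

lemma simplex_subset: "\<tau> \<in> K \<Longrightarrow> \<tau> \<subseteq> {..<m}"
  by (simp add: boundary_complex_def)

lemma finite_simplex: "\<tau> \<in> K \<Longrightarrow> finite \<tau>"
  using simplex_subset finite_subset by blast

lemma simplex_face:
  assumes "\<tau> \<in> K"
  shows "convex hull (v ` \<tau>) face_of P" "convex hull (v ` \<tau>) \<noteq> P"
  using assms by (auto simp: boundary_complex_def)

lemma proper_face_vertices:
  assumes "F face_of P" "F \<noteq> P"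
  shows "\<exists>\<tau>\<in>K. F = convex hull (v ` \<tau>) \<and> \<not> affine_dependent (v ` \<tau>)"
proof -
  obtain C where C: "\<not> affine_dependent C" "F = convex hull C"
    using simplicial assms unfolding simplicial_polytope_def simplex_def by blast
  have "C \<subseteq> v ` {..<m}"
    using extreme_point_of_convex_hull_affine_independent[OF C(1)] C(2)
      extreme_point_of_face[OF assms(1)] extreme_points_eq by blast
  then obtain \<tau> where "\<tau> \<subseteq> {..<m}" "C = v ` \<tau>" by (meson subset_imageE)
  then show ?thesis using C assms by (auto simp: boundary_complex_def)
qed

lemma extreme_points_of_simplex:
  assumes "\<tau> \<in> K"
  shows "{x. x extreme_point_of (convex hull (v ` \<tau>))} = v ` \<tau>"
proof
  show "v ` \<tau> \<subseteq> {x. x extreme_point_of (convex hull (v ` \<tau>))}"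
    using extreme_point_of_face[OF simplex_face(1)[OF assms]] extreme_points_eq
      simplex_subset[OF assms] by (auto simp: hull_inc)
qed (rule extreme_points_of_convex_hull)

lemma simplex_affine_independent:
  assumes "\<tau> \<in> K"
  shows "\<not> affine_dependent (v ` \<tau>)"
proof -
  obtain \<tau>' where \<tau>': "convex hull (v ` \<tau>) = convex hull (v ` \<tau>')" "\<not> affine_dependent (v ` \<tau>')"
    using proper_face_vertices[OF simplex_face[OF assms]] by blast
  have "v ` \<tau>' = {x. x extreme_point_of (convex hull (v ` \<tau>'))}"
    using extreme_point_of_convex_hull_affine_independent[OF \<tau>'(2)] by blast
  also have "\<dots> = v ` \<tau>"
    unfolding \<tau>'(1)[symmetric] by (rule extreme_points_of_simplex[OF assms])
  finally have "v ` \<tau>' = v ` \<tau>" .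
  then show ?thesis using \<tau>'(2) by argo
qed

lemma aff_dim_simplex_eq:
  assumes "\<tau> \<in> K"
  shows "aff_dim (convex hull (v ` \<tau>)) = int (card \<tau>) - 1"
proof -
  have "card (v ` \<tau>) = card \<tau>"
    using card_image inj_on_subset[OF inj_labels simplex_subset[OF assms]] by blast
  then show ?thesis
    using aff_dim_affine_independent[OF simplex_affine_independent[OF assms]]
    unfolding aff_dim_convex_hull by linarith
qed

lemma card_simplex_le:
  assumes "\<tau> \<in> K"
  shows "card \<tau> \<le> n"
  using face_of_aff_dim_lt[OF polytope_imp_convex[OF polytope] simplex_face[OF assms]]
  unfolding aff_dim_simplex_eq[OF assms] aff_dim_eq by linarith

lemma simplex_subsets:
  assumes "\<tau> \<in> K" "\<rho> \<subseteq> \<tau>"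
  shows "\<rho> \<in> K"
proof -
  have "convex hull (v ` \<rho>) face_of convex hull (v ` \<tau>)"
    using face_of_convex_hull_affine_independent[OF simplex_affine_independent[OF assms(1)]] assms(2)
    by blast
  moreover have "convex hull (v ` \<rho>) \<subseteq> convex hull (v ` \<tau>)"
    using assms(2) by (intro hull_mono image_mono)
  ultimately show ?thesis
    using simplex_face[OF assms(1)] simplex_subset[OF assms(1)] assms(2)
      face_of_imp_subset[OF simplex_face(1)[OF assms(1)]] face_of_trans
    unfolding boundary_complex_def by blast
qed

lemma facet_simplex:
  assumes "F facet_of P"
  shows "\<exists>\<tau>\<in>K. F = convex hull (v ` \<tau>) \<and> card \<tau> = n"
proof -
  have F: "F face_of P" "F \<noteq> P" "aff_dim F = aff_dim P - 1"
    using assms by (auto simp: facet_of_def)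
  then obtain \<tau> where "\<tau> \<in> K" "F = convex hull (v ` \<tau>)" using proper_face_vertices by blast
  moreover from this have "int (card \<tau>) - 1 = int n - 1"
    using aff_dim_simplex_eq F(3) aff_dim_eq by metis
  ultimately show ?thesis by auto
qed

lemma facet_exists: "\<exists>\<sigma>\<in>K. card \<sigma> = n"
proof -
  have "0 < aff_dim P" using aff_dim_eq dim_pos by simp
  then obtain F where "F facet_of P" using polytope_facet_exists[OF polytope] by blast
  then show ?thesis using facet_simplex by blast
qed

lemma vertex_of_face:
  assumes "\<tau> \<in> K" "j < m" "v j \<in> convex hull (v ` \<tau>)"
  shows "j \<in> \<tau>"
proof -
  have "v j extreme_point_of (convex hull (v ` \<tau>))"
    using assms extreme_points_eq extreme_point_of_face[OF simplex_face(1)[OF assms(1)]] by blast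
  then have "v j \<in> v ` \<tau>" using extreme_points_of_simplex[OF assms(1)] by blast
  then show ?thesis
    using inj_on_image_mem_iff[OF inj_labels _ simplex_subset[OF assms(1)]] assms(2) by blast
qed

lemma vertex_in_polytope: "j < m \<Longrightarrow> v j \<in> P"
  using extreme_points_eq by (auto simp: extreme_point_of_def)

text \<open>A face is exposed, and its supporting hyperplane misses the interior point \<open>p\<close>, so the
  supporting functional can be normalised to be \<open>1\<close> on the face as seen from \<open>p\<close>.\<close>

lemma supporting_functional:
  assumes \<tau>: "\<tau> \<in> K" and p: "p \<in> rel_interior P"
  shows "\<exists>c. (\<forall>j\<in>\<tau>. c \<bullet> (v j - p) = 1) \<and> (\<forall>j<m. j \<notin> \<tau> \<longrightarrow> c \<bullet> (v j - p) < 1)"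
proof -
  let ?F = "convex hull (v ` \<tau>)"
  obtain a b where ab: "P \<subseteq> {x. a \<bullet> x \<le> b}" "?F = P \<inter> {x. a \<bullet> x = b}"
    using exposed_face_of_polyhedron[OF polytope_imp_polyhedron[OF polytope]] simplex_face(1)[OF \<tau>]
    unfolding exposed_face_of_def by blast
  have "p \<in> P" using p rel_interior_subset by blast
  moreover have "p \<notin> ?F"
    using face_of_disjoint_rel_interior[OF simplex_face[OF \<tau>]] p by blast
  ultimately have pos: "0 < b - a \<bullet> p" using ab by force
  have eq: "(a /\<^sub>R (b - a \<bullet> p)) \<bullet> (v j - p) = (a \<bullet> v j - a \<bullet> p) / (b - a \<bullet> p)" for j
    unfolding inner_scaleR_left by (simp add: inner_diff_right divide_inverse_commute)
  have "(a /\<^sub>R (b - a \<bullet> p)) \<bullet> (v j - p) = 1" if "j \<in> \<tau>" for j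
  proof -
    have "v j \<in> ?F" using that by (simp add: hull_inc)
    then have "a \<bullet> v j = b" using ab(2) by blast
    then show ?thesis unfolding eq using pos by simp
  qed
  moreover have "(a /\<^sub>R (b - a \<bullet> p)) \<bullet> (v j - p) < 1" if "j < m" "j \<notin> \<tau>" for j
  proof -
    have "v j \<notin> ?F" using vertex_of_face[OF \<tau>] that by blast
    then have "a \<bullet> v j < b" using ab vertex_in_polytope[OF that(1)] by force
    then show ?thesis unfolding eq using pos by simp
  qed
  ultimately show ?thesis by blast
qed

text \<open>The point \<open>p\<close> lies outside the affine hull of a facet, so the vertices of the facet seen from \<open>p\<close> are
  linearly independent, and there are as many of them as the dimension of \<open>P\<close>.\<close>

lemma facet_basis:
  assumes \<tau>: "\<tau> \<in> K" "card \<tau> = n" and p: "p \<in> rel_interior P"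
  shows "independent ((\<lambda>j. v j - p) ` \<tau>)" "j < m \<Longrightarrow> v j - p \<in> span ((\<lambda>j. v j - p) ` \<tau>)"
proof -
  have "p \<notin> affine hull (v ` \<tau>)"
    using affine_hull_face_of_disjoint_rel_interior[OF polytope_imp_convex[OF polytope] simplex_face[OF \<tau>(1)]] p
    by auto
  then have "\<not> affine_dependent (insert p (v ` \<tau>))" and "p \<notin> v ` \<tau>"
    using affine_independent_insert[OF simplex_affine_independent[OF \<tau>(1)]]
      hull_inc[of p "v ` \<tau>" affine] by auto
  then show ind: "independent ((\<lambda>j. v j - p) ` \<tau>)"
    using affine_dependent_iff_dependent[of p "v ` \<tau>"] by (simp add: image_image)
  have pP: "p \<in> P" using p rel_interior_subset by blast
  let ?V = "(\<lambda>x. x - p) ` P"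
  have "int (dim ?V) = int n"
    using aff_dim_eq_dim_subtract[of p P] pP aff_dim_eq by (simp add: hull_inc)
  moreover have "inj_on (\<lambda>j. v j - p) \<tau>"
    using inj_on_subset[OF inj_labels simplex_subset[OF \<tau>(1)]] by (auto simp: inj_on_def)
  moreover have "(\<lambda>j. v j - p) ` \<tau> \<subseteq> ?V"
    using vertex_in_polytope simplex_subset[OF \<tau>(1)] by blast
  ultimately have "?V \<subseteq> span ((\<lambda>j. v j - p) ` \<tau>)"
    using card_ge_dim_independent[OF _ ind, of ?V] \<tau>(2) by (simp add: card_image)
  then show "j < m \<Longrightarrow> v j - p \<in> span ((\<lambda>j. v j - p) ` \<tau>)"
    using vertex_in_polytope by blast
qed

text \<open>Two facets that share the ridge \<open>\<rho>\<close> have normalised supporting functionals that agree on \<open>\<rho>\<close>; their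
  difference vanishes on \<open>\<rho>\<close> and has opposite signs at the two remaining vertices.\<close>

lemma facets_separated:
  assumes p: "p \<in> rel_interior P" and ab: "a \<noteq> b" "a \<notin> \<rho>" "b \<notin> \<rho>"
    and a: "insert a \<rho> \<in> K" and b: "insert b \<rho> \<in> K"
  shows "\<exists>c. (\<forall>j\<in>\<rho>. c \<bullet> (v j - p) = 0) \<and> c \<bullet> (v a - p) < 0 \<and> c \<bullet> (v b - p) > 0"
proof -
  obtain c where c: "\<forall>j\<in>insert a \<rho>. c \<bullet> (v j - p) = 1" "\<forall>j<m. j \<notin> insert a \<rho> \<longrightarrow> c \<bullet> (v j - p) < 1"
    using supporting_functional[OF a p] by blast
  obtain d where d: "\<forall>j\<in>insert b \<rho>. d \<bullet> (v j - p) = 1" "\<forall>j<m. j \<notin> insert b \<rho> \<longrightarrow> d \<bullet> (v j - p) < 1"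
    using supporting_functional[OF b p] by blast
  have "a < m" "b < m" using simplex_subset[OF a] simplex_subset[OF b] by auto
  then show ?thesis
    using c d ab by (intro exI[of _ "d - c"]) (auto simp: inner_diff_left)
qed

text \<open>Modulo the span of the ridge the ambient space is a line, and the two vertices off the ridge
  lie on opposite rays of it.\<close>

lemma opposite_sides:
  assumes p: "p \<in> rel_interior P" and ab: "a \<noteq> b" "a \<notin> \<rho>" "b \<notin> \<rho>"
    and a: "insert a \<rho> \<in> K" and b: "insert b \<rho> \<in> K" and n: "card (insert a \<rho>) = n"
  shows "\<exists>\<gamma><0. (v b - p) - \<gamma> *\<^sub>R (v a - p) \<in> span ((\<lambda>j. v j - p) ` \<rho>)"
proof -
  have "b < m" using simplex_subset[OF b] by auto
  then have "v b - p \<in> span (insert (v a - p) ((\<lambda>j. v j - p) ` \<rho>))"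
    using facet_basis(2)[OF a n p, of b] by simp
  then obtain \<gamma> where \<gamma>: "(v b - p) - \<gamma> *\<^sub>R (v a - p) \<in> span ((\<lambda>j. v j - p) ` \<rho>)"
    unfolding span_breakdown_eq by blast
  obtain c where c: "\<forall>j\<in>\<rho>. c \<bullet> (v j - p) = 0" "c \<bullet> (v a - p) < 0" "c \<bullet> (v b - p) > 0"
    using facets_separated[OF p ab a b] by blast
  have "c \<bullet> y = 0" if "y \<in> span ((\<lambda>j. v j - p) ` \<rho>)" for y
    using that by (induction rule: span_induct_alt) (auto simp: c(1) inner_add_right)
  from this[OF \<gamma>] have "c \<bullet> (v b - p) = \<gamma> * (c \<bullet> (v a - p))" by (simp add: inner_diff_right)
  then have "\<gamma> < 0" using c by (metis mult_nonneg_nonpos not_less less_imp_le)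
  then show ?thesis using \<gamma> by blast
qed

text \<open>A nonempty proper face is the intersection of the facets containing it, so a ridge lies in a
  second facet.  In dimension one the ridge is empty, and this becomes the existence of a
  second vertex.\<close>

lemma ridge_other_facet:
  assumes a: "insert a \<rho> \<in> K" "a \<notin> \<rho>" and n: "card (insert a \<rho>) = n"
  shows "\<exists>b. b \<noteq> a \<and> b \<notin> \<rho> \<and> insert b \<rho> \<in> K"
proof (cases "\<rho> = {}")
  case True
  then have n1: "n = 1" using n by simp
  have am: "a < m" using simplex_subset[OF a(1)] by auto
  have "\<exists>b. b \<noteq> a \<and> b < m"
  proof (rule ccontr)
    assume "\<not> ?thesis"
    then have "{x. x extreme_point_of P} = {v a}" unfolding extreme_points_eq using am by auto
    then have "P = convex hull {v a}"
      using Krein_Milman_Minkowski[OF polytope_imp_compact[OF polytope] polytope_imp_convex[OF polytope]]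
      by simp
    then have "aff_dim P = 0" by simp
    then show False using aff_dim_eq n1 by simp
  qed
  then obtain b where b: "b \<noteq> a" "b < m" by blast
  have "{v b} face_of P" using b extreme_points_eq face_of_singleton by blast
  moreover have "{v b} \<noteq> P" using aff_dim_eq n1 aff_dim_sing[of "v b"] by auto
  ultimately have "{b} \<in> K" using b by (simp add: boundary_complex_def)
  then show ?thesis using b True by blast
next
  case False
  have r: "\<rho> \<in> K" using simplex_subsets[OF a(1)] by blast
  let ?R = "convex hull (v ` \<rho>)"
  have "?R \<noteq> {}" using False by simp
  then have R: "?R = \<Inter>{F. F facet_of P \<and> ?R \<subseteq> F}"
    using face_of_polyhedron[OF polytope_imp_polyhedron[OF polytope] simplex_face(1)[OF r] _ simplex_face(2)[OF r]]
    by blast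
  have "v a \<notin> ?R"
    using vertex_of_face[OF r] simplex_subset[OF a(1)] a(2) by auto
  then obtain F where F: "F facet_of P" "?R \<subseteq> F" "v a \<notin> F" using R by blast
  obtain \<tau> where \<tau>: "\<tau> \<in> K" "F = convex hull (v ` \<tau>)" "card \<tau> = n" using facet_simplex[OF F(1)] by blast
  have "\<rho> \<subseteq> \<tau>"
  proof
    fix j assume "j \<in> \<rho>"
    then have "v j \<in> ?R" "j < m" using simplex_subset[OF r] by (auto simp: hull_inc)
    then show "j \<in> \<tau>" using vertex_of_face[OF \<tau>(1)] F(2) \<tau>(2) by blast
  qed
  moreover have "card (\<tau> - \<rho>) = 1"
    using card_Diff_subset[OF finite_simplex[OF r] \<open>\<rho> \<subseteq> \<tau>\<close>] n \<tau>(3) a(2) finite_simplex[OF r] by simp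
  then obtain b where "\<tau> - \<rho> = {b}" by (auto simp: card_1_singleton_iff)
  ultimately have "\<tau> = insert b \<rho>" "b \<notin> \<rho>" by auto
  moreover have "b \<noteq> a" using F(3) \<tau>(2) calculation(1) by (auto simp: hull_inc)
  ultimately show ?thesis using \<tau>(1) by blast
qed

text \<open>The coefficient of a facet is the sign of a determinant of its vertices seen from an interior
  point.  By \<open>minor_insert\<close> and \<open>opposite_sides\<close>, the contributions of the two
  facets at a ridge cancel.  Taking as rows the basis dual to the chosen facet \<open>\<sigma>\<close> makes the coefficient of \<open>\<sigma>\<close>
  nonzero.\<close>

lemma fundamental_cycle:
  assumes \<sigma>: "\<sigma> \<in> K" "card \<sigma> = n"
  shows "\<exists>\<epsilon> :: nat set \<Rightarrow> rat. \<epsilon> \<sigma> \<noteq> 0 \<and>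
    (\<forall>\<rho>. finite \<rho> \<and> Suc (card \<rho>) = n \<longrightarrow>
      (\<Sum>i\<in>{i. i \<notin> \<rho> \<and> insert i \<rho> \<in> K}. (-1) ^ card {j \<in> \<rho>. j < i} * \<epsilon> (insert i \<rho>)) = 0)"
proof -
  have "convex P" "P \<noteq> {}" using polytope polytope_imp_convex aff_dim_eq by auto
  then obtain p where p: "p \<in> rel_interior P" using rel_interior_eq_empty by blast
  define x where "x j = v j - p" for j
  obtain g where g: "bij_betw g {..<n} \<sigma>"
    using \<sigma> finite_simplex ex_bij_betw_nat_finite[of \<sigma>] by (auto simp: atLeast0LessThan)
  have inj: "inj_on x \<sigma>"
    using inj_on_subset[OF inj_labels simplex_subset[OF \<sigma>(1)]] by (auto simp: inj_on_def x_def)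
  have ind: "independent (x ` \<sigma>)" using facet_basis(1)[OF \<sigma> p] by (simp add: x_def[abs_def])
  have "\<exists>f. linear f \<and> (\<forall>y\<in>x ` \<sigma>. f y = (if y = x (g k) then 1 else 0 :: real))" for k
    by (rule linear_independent_extend[OF ind])
  then have "\<exists>f. \<forall>k. linear (f k) \<and> (\<forall>y\<in>x ` \<sigma>. f k y = (if y = x (g k) then 1 else 0 :: real))"
    by (intro choice allI)
  then obtain f where f: "\<And>k. linear (f k)"
    "\<And>k y. y \<in> x ` \<sigma> \<Longrightarrow> f k y = (if y = x (g k) then 1 else 0 :: real)"
    by blast
  have "f k (x (g l)) = (if k = l then 1 else 0)" if "k < n" "l < n" for k l
  proof -
    have "g k \<in> \<sigma>" "g l \<in> \<sigma>" using g that by (auto simp: bij_betw_def)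
    moreover have "g l = g k \<longleftrightarrow> l = k"
      using inj_on_eq_iff[OF bij_betw_imp_inj_on[OF g], of l k] that by simp
    ultimately show ?thesis
      using f(2)[of "x (g l)" k] inj_on_eq_iff[OF inj, of "g l" "g k"] by auto
  qed
  from minor_dual_basis_nonzero[of g n f x, OF bij_betw_imp_inj_on[OF g] this]
  have nz: "minor f x n \<sigma> \<noteq> 0" unfolding bij_betw_imp_surj_on[OF g] .
  define sg :: "real \<Rightarrow> rat" where "sg r = (if 0 < r then 1 else if r < 0 then -1 else 0)" for r
  define \<epsilon> where "\<epsilon> \<tau> = sg (minor f x n \<tau>)" for \<tau>
  have "(\<Sum>i\<in>{i. i \<notin> \<rho> \<and> insert i \<rho> \<in> K}. (-1) ^ card {j \<in> \<rho>. j < i} * \<epsilon> (insert i \<rho>)) = 0"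
    if \<rho>: "finite \<rho>" "Suc (card \<rho>) = n" for \<rho>
  proof -
    let ?I = "{i. i \<notin> \<rho> \<and> insert i \<rho> \<in> K}"
    obtain L :: "'a \<Rightarrow> real" where L: "linear L" "\<forall>j\<in>\<rho>. L (x j) = 0"
      "\<And>i. i \<notin> \<rho> \<Longrightarrow> minor f x n (insert i \<rho>) = (-1) ^ card {j \<in> \<rho>. j < i} * L (x i)"
    proof -
      have "Suc (card \<rho>) = n" by (rule \<rho>(2))
      with minor_insert[of f \<rho> "card \<rho>" x, OF f(1) \<rho>(1) refl] show ?thesis
        using that by (auto simp del: minor.simps)
    qed
    have L0: "L y = 0" if "y \<in> span (x ` \<rho>)" for y
      using that L(2) by (induction rule: span_induct_alt)
        (auto simp: linear_0[OF L(1)] linear_add[OF L(1)] linear_scale[OF L(1)])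
    have summand: "(-1) ^ card {j \<in> \<rho>. j < i} * \<epsilon> (insert i \<rho>) = sg (L (x i))" if "i \<notin> \<rho>" for i
    proof -
      have "s * sg (of_int t * r) = sg r" if "(s, t) = (1, 1) \<or> (s, t) = (-1, -1)" for s :: rat and t r
        using that by (auto simp: sg_def)
      moreover have "((-1) ^ c :: rat, (-1) ^ c :: int) = (1, 1) \<or> ((-1) ^ c :: rat, (-1) ^ c :: int) = (-1, -1)" for c
        by (cases "even c") auto
      ultimately have "(-1) ^ c * sg (of_int ((-1) ^ c) * r) = sg r" for c r by blast
      then show ?thesis unfolding \<epsilon>_def L(3)[OF that] by simp
    qed
    have card: "card (insert i \<rho>) = n" if "i \<in> ?I" for i using that \<rho> by simp
    show ?thesis
    proof (cases "?I = {}")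
      case False
      then obtain a where a: "a \<in> ?I" by blast
      then obtain b where b: "b \<in> ?I" "b \<noteq> a" using ridge_other_facet[of a \<rho>] card by blast
      have sides: "\<exists>\<gamma><0. x j - \<gamma> *\<^sub>R x i \<in> span (x ` \<rho>)" if "i \<in> ?I" "j \<in> ?I" "i \<noteq> j" for i j
        using opposite_sides[OF p that(3), of \<rho>] that card[OF that(1)] by (auto simp: x_def[abs_def])
      \<comment> \<open>A third facet at the ridge would lie opposite to each of the other two.\<close>
      have "?I = {a, b}"
      proof (rule ccontr)
        assume "\<not> ?thesis"
        then obtain d where d: "d \<in> ?I" "d \<noteq> a" "d \<noteq> b" using a b by blast
        obtain c where c: "\<forall>j\<in>\<rho>. c \<bullet> x j = 0" "c \<bullet> x a < 0" "c \<bullet> x b > 0"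
          using facets_separated[OF p, of a b \<rho>] a b by (auto simp: x_def)
        have c0: "c \<bullet> y = 0" if "y \<in> span (x ` \<rho>)" for y
          using that by (induction rule: span_induct_alt) (auto simp: c(1) inner_add_right)
        obtain \<gamma> where \<gamma>: "\<gamma> < 0" "c \<bullet> x d = \<gamma> * (c \<bullet> x a)"
          using sides[OF a d(1)] d c0 by (force simp: inner_diff_right)
        obtain \<delta> where \<delta>: "\<delta> < 0" "c \<bullet> x d = \<delta> * (c \<bullet> x b)"
          using sides[OF b(1) d(1)] d c0 by (force simp: inner_diff_right)
        show False using \<gamma> \<delta> c by (metis mult_neg_neg mult_neg_pos less_asym)
      qed
      moreover obtain \<gamma> where \<gamma>: "\<gamma> < 0" "x b - \<gamma> *\<^sub>R x a \<in> span (x ` \<rho>)"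
        using sides[OF a b(1)] b(2) by blast
      have Lb: "L (x b) = \<gamma> * L (x a)"
        using L0[OF \<gamma>(2)] by (simp add: linear_diff[OF L(1)] linear_scale[OF L(1)])
      have "sg (L (x b)) = - sg (L (x a))"
        using \<gamma>(1) unfolding Lb by (auto simp: sg_def zero_less_mult_iff mult_less_0_iff)
      moreover have "a \<notin> \<rho>" "b \<notin> \<rho>" using a b by auto
      ultimately show ?thesis using b(2) by (simp add: summand)
    next
      case True
      show ?thesis unfolding True by simp
    qed
  qed
  moreover have "\<epsilon> \<sigma> \<noteq> 0" using nz by (auto simp: \<epsilon>_def sg_def)
  ultimately show ?thesis by blast
qed

end

section \<open>Cup products of singular cocycles\<close>

text \<open>The inclusion of a standard simplex as a back face of a larger one.\<close>

definition shift_simplex :: "nat \<Rightarrow> (nat \<Rightarrow> real) \<Rightarrow> nat \<Rightarrow> real" where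
  "shift_simplex p x = (\<lambda>i. if i < p then 0 else x (i - p))"

lemma shift_in_standard_simplex:
  assumes "x \<in> standard_simplex q"
  shows "shift_simplex p x \<in> standard_simplex (p + q)"
proof -
  have "(\<Sum>i\<le>p + q. shift_simplex p x i) = (\<Sum>i\<in>{p..p + q}. x (i - p))"
    by (rule sum.mono_neutral_cong_right) (auto simp: shift_simplex_def)
  also have "\<dots> = (\<Sum>i\<le>q. x i)"
    by (rule sum.reindex_bij_witness[of _ "\<lambda>i. i + p" "\<lambda>i. i - p"]) auto
  finally show ?thesis
    using assms by (auto simp: standard_simplex_def shift_simplex_def)
qed

lemma back_face_shift: "back_face p q f = restrict (f \<circ> shift_simplex p) (standard_simplex q)"
  by (simp add: back_face_def shift_simplex_def comp_def)

lemma simplical_face_shift: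
  "k \<le> p \<Longrightarrow> simplical_face k (shift_simplex p x) = shift_simplex (Suc p) x"
  "p \<le> k \<Longrightarrow> simplical_face k (shift_simplex p x) = shift_simplex p (simplical_face (k - p) x)"
  by (auto simp: simplical_face_def shift_simplex_def fun_eq_iff)

lemma simplical_face_trivial:
  assumes "x \<in> standard_simplex p" "p < k"
  shows "simplical_face k x = x"
  using assms by (auto simp: simplical_face_def standard_simplex_def fun_eq_iff)

lemma singular_simplex_front_face:
  assumes "singular_simplex (p + q) X f"
  shows "singular_simplex p X (front_face p f)"
proof -
  have "continuous_map (subtopology (powertop_real UNIV) (standard_simplex p)) X f"
    using assms standard_simplex_mono[of p "p + q"]
    by (auto simp: singular_simplex_def intro: continuous_map_from_subtopology_mono)
  then show ?thesis
    unfolding singular_simplex_def front_face_def by (auto intro: continuous_map_eq)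
qed

lemma singular_simplex_back_face:
  assumes "singular_simplex (p + q) X f"
  shows "singular_simplex q X (back_face p q f)"
proof -
  have "continuous_map (powertop_real UNIV) euclideanreal (\<lambda>x. shift_simplex p x i)" for i
    by (cases "i < p") (auto simp: shift_simplex_def intro: continuous_map_product_projection)
  then have "continuous_map (subtopology (powertop_real UNIV) (standard_simplex q))
      (subtopology (powertop_real UNIV) (standard_simplex (p + q))) (shift_simplex p)"
    by (auto simp: continuous_map_in_subtopology continuous_map_componentwise
        shift_in_standard_simplex continuous_map_from_subtopology)
  then have "continuous_map (subtopology (powertop_real UNIV) (standard_simplex q)) X (f \<circ> shift_simplex p)"
    using assms continuous_map_compose unfolding singular_simplex_def by blast
  then show ?thesis
    unfolding singular_simplex_def back_face_shift by (auto intro: continuous_map_eq)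
qed

lemma front_face_singular_face:
  assumes "k \<le> p"
  shows "front_face p (singular_face (Suc (p + q)) k f) = singular_face (Suc p) k (front_face (Suc p) f)"
  using assms standard_simplex_mono[of p "p + q"] simplical_face_in_standard_simplex[of "Suc p" k]
  by (auto simp: front_face_def singular_face_def fun_eq_iff restrict_def)

lemma front_face_singular_face_late:
  assumes "p < k"
  shows "front_face p (singular_face (Suc (p + q)) k f) = front_face p f"
  using standard_simplex_mono[of p "p + q"]
  by (auto simp: front_face_def singular_face_def restrict_def simplical_face_trivial[OF _ assms]
      intro!: ext)

lemma back_face_singular_face_early:
  assumes "k \<le> p"
  shows "back_face p q (singular_face (Suc (p + q)) k f) = back_face (Suc p) q f"
  using assms shift_in_standard_simplex[of _ q p]
  by (auto simp: back_face_shift singular_face_def fun_eq_iff restrict_def simplical_face_shift)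

lemma back_face_singular_face:
  assumes "p \<le> k" "k \<le> Suc (p + q)"
  shows "back_face p q (singular_face (Suc (p + q)) k f) = singular_face (Suc q) (k - p) (back_face p (Suc q) f)"
proof -
  have "simplical_face (k - p) x \<in> standard_simplex (Suc q)" if "x \<in> standard_simplex q" for x :: "nat \<Rightarrow> real"
    using simplical_face_in_standard_simplex[of "Suc q" "k - p" x] assms that by auto
  then show ?thesis
    using assms shift_in_standard_simplex[of _ q p]
    by (auto simp: back_face_shift singular_face_def fun_eq_iff restrict_def simplical_face_shift(2))
qed

lemma cocycle_sum:
  assumes "a \<in> cocycles p X" "singular_simplex (Suc p) X f"
  shows "(\<Sum>k\<le>Suc p. (-1) ^ k * a (singular_face (Suc p) k f)) = 0"
proof -
  have "coboundary p X a f = 0" using assms(1) by (simp add: cocycles_def)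
  then show ?thesis using assms(2) by (simp only: coboundary_def if_True)
qed

text \<open>The Leibniz rule for cocycles.  The faces opposite to the first \<open>p + 1\<close> vertices only affect
  the front factor, and the remaining ones only the back factor.  By the cocycle conditions
  each of the two partial sums reduces, up to sign, to the same product of the front
  \<open>p\<close>-face and the back \<open>q\<close>-face, and the signs are opposite.\<close>

lemma cochain_cup_cocycle:
  assumes a: "a \<in> cocycles p X" and b: "b \<in> cocycles q X"
  shows "cochain_cup p q X a b \<in> cocycles (p + q) X"
proof -
  have "coboundary (p + q) X (cochain_cup p q X a b) f = 0" for f
  proof (cases "singular_simplex (Suc (p + q)) X f")
    case f: True
    let ?n = "Suc (p + q)" and ?c = "cochain_cup p q X a b"
    let ?A = "a (front_face p f)" and ?B = "b (back_face (Suc p) q f)"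
    let ?g = "\<lambda>k. (-1) ^ k * ?c (singular_face ?n k f)"
    have c: "?c (singular_face ?n k f) =
        a (front_face p (singular_face ?n k f)) * b (back_face p q (singular_face ?n k f))" if "k \<le> ?n" for k
      using singular_simplex_singular_face[OF f, of k] that by (simp add: cochain_cup_def)
    have front_simplex: "singular_simplex (Suc p) X (front_face (Suc p) f)"
      using singular_simplex_front_face[of "Suc p" q X f] f by simp
    have back_simplex: "singular_simplex (Suc q) X (back_face p (Suc q) f)"
      using singular_simplex_back_face[of p "Suc q" X f] f by simp
    have "front_face p f = singular_face (Suc p) (Suc p) (front_face (Suc p) f)"
      using standard_simplex_mono[of p "Suc p"]
      by (auto simp: front_face_def singular_face_def restrict_def simplical_face_trivial[of _ p "Suc p"]
          intro!: ext)
    then have front_sum: "(\<Sum>k\<le>p. (-1) ^ k * a (singular_face (Suc p) k (front_face (Suc p) f))) = (-1) ^ p * ?A"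
      using cocycle_sum[OF a front_simplex] by simp
    have "simplical_face 0 (x :: nat \<Rightarrow> real) \<in> standard_simplex (Suc q)" if "x \<in> standard_simplex q" for x
      using simplical_face_in_standard_simplex[of "Suc q" 0 x] that by auto
    then have "back_face (Suc p) q f = singular_face (Suc q) 0 (back_face p (Suc q) f)"
      using simplical_face_shift(1)[of p p] simplical_face_shift(2)[of p p]
      by (auto simp: back_face_shift singular_face_def restrict_def intro!: ext)
    then have back_sum: "(\<Sum>l\<le>q. (-1) ^ Suc l * b (singular_face (Suc q) (Suc l) (back_face p (Suc q) f))) = - ?B"
      using cocycle_sum[OF b back_simplex] by (simp only: sum.atMost_Suc_shift) simp
    have e: "{..?n} = {..p} \<union> {Suc p..?n}" by auto
    have "(\<Sum>k\<le>?n. ?g k) = (\<Sum>k\<le>p. ?g k) + (\<Sum>k\<in>{Suc p..?n}. ?g k)"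
      unfolding e by (rule sum.union_disjoint) auto
    also have "(\<Sum>k\<le>p. ?g k) = (\<Sum>k\<le>p. (-1) ^ k * a (singular_face (Suc p) k (front_face (Suc p) f)) * ?B)"
      by (rule sum.cong) (simp_all add: c front_face_singular_face back_face_singular_face_early)
    also have "\<dots> = (-1) ^ p * ?A * ?B"
      unfolding sum_distrib_right[symmetric] front_sum ..
    also have "(\<Sum>k\<in>{Suc p..?n}. ?g k)
        = (\<Sum>l\<le>q. (-1) ^ p * ?A * ((-1) ^ Suc l * b (singular_face (Suc q) (Suc l) (back_face p (Suc q) f))))"
    proof -
      have "(\<Sum>k\<in>{Suc p..?n}. ?g k) = (\<Sum>l\<le>q. ?g (Suc (p + l)))"
        by (rule sum.reindex_bij_witness[of _ "\<lambda>l. Suc (p + l)" "\<lambda>k. k - Suc p"]) auto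
      also have "\<dots> = (\<Sum>l\<le>q. (-1) ^ p * ?A * ((-1) ^ Suc l * b (singular_face (Suc q) (Suc l) (back_face p (Suc q) f))))"
        by (rule sum.cong[OF refl])
          (simp add: c front_face_singular_face_late back_face_singular_face power_add Suc_diff_le)
      finally show ?thesis .
    qed
    also have "\<dots> = - ((-1) ^ p * ?A * ?B)"
      unfolding sum_distrib_left[symmetric] back_sum by simp
    finally show ?thesis using f by (simp add: coboundary_def)
  qed (simp add: coboundary_def)
  then show ?thesis by (auto simp: cocycles_def cochains_def cochain_cup_def)
qed

lemma unit_cochain_cocycle: "(\<lambda>f. if singular_simplex 0 X f then 1 else 0) \<in> cocycles 0 X"
proof -
  have "singular_simplex 0 X (singular_face (Suc 0) k f)" if "singular_simplex (Suc 0) X f" "k \<le> Suc 0" for f k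
    using singular_simplex_singular_face[OF that(1) _ that(2)] by simp
  then show ?thesis by (auto simp: cocycles_def cochains_def coboundary_def fun_eq_iff)
qed

lemma cohomologous_refl:
  assumes "a \<in> cocycles p X"
  shows "(a, a) \<in> cohomologous p X"
proof -
  have "(\<lambda>_. 0) \<in> coboundaries p X"
  proof (cases p)
    case (Suc q)
    have "coboundary q X (\<lambda>_. 0) = (\<lambda>_. 0)" by (simp add: coboundary_def fun_eq_iff)
    moreover have "(\<lambda>_. 0) \<in> cochains q X" by (simp add: cochains_def)
    ultimately show ?thesis using Suc by (auto simp: coboundaries_def image_iff intro!: bexI[of _ "\<lambda>_. 0"])
  qed (simp add: coboundaries_def)
  then show ?thesis using assms by (simp add: cohomologous_def)
qed

text \<open>A representative for the iterated cup product of degree-one classes.\<close>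

fun cup_cochains :: "'a topology \<Rightarrow> 'a cochain list \<Rightarrow> 'a cochain" where
  "cup_cochains X [] = (\<lambda>f. if singular_simplex 0 X f then 1 else 0)"
| "cup_cochains X (a # as) = cochain_cup 1 (length as) X a (cup_cochains X as)"

lemma cup_cochains_cocycle:
  "set as \<subseteq> cocycles 1 X \<Longrightarrow> cup_cochains X as \<in> cocycles (length as) X"
proof (induction as)
  case (Cons a as)
  then show ?case using cochain_cup_cocycle[of a 1 X "cup_cochains X as" "length as"] by simp
qed (simp add: unit_cochain_cocycle)

lemma cup_cochains_in_cup_list:
  "set as \<subseteq> cocycles 1 X \<Longrightarrow>
    cup_cochains X as \<in> cup_list X (map (\<lambda>a. (1, cohomologous 1 X `` {a})) as)"
proof (induction as)
  case Nil
  then show ?case using cohomologous_refl[OF unit_cochain_cocycle] by (auto simp: unit_class_def)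
next
  case (Cons a as)
  have deg: "sum_list (map fst (map (\<lambda>a. (1::nat, cohomologous 1 X `` {a})) as)) = length as"
    by (induction as) auto
  have "a \<in> cohomologous 1 X `` {a}" using cohomologous_refl[of a 1 X] Cons.prems by simp
  moreover have "cup_cochains X (a # as) \<in> cohomologous (1 + length as) X `` {cochain_cup 1 (length as) X a (cup_cochains X as)}"
    using cohomologous_refl[OF cup_cochains_cocycle[OF Cons.prems]] by simp
  ultimately show ?case
    using Cons unfolding list.map cup_list.simps deg cup_def by auto
qed

lemma front_face_oriented_simplex:
  "front_face p (oriented_simplex (p + q) l) = oriented_simplex p l"
proof -
  have "(\<Sum>j\<le>p + q. l j i * x j) = (\<Sum>j\<le>p. l j i * x j)" if "x \<in> standard_simplex p" for x i
    using that by (intro sum.mono_neutral_right) (auto simp: standard_simplex_def)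
  then show ?thesis
    using standard_simplex_mono[of p "p + q"]
    by (auto simp: front_face_def oriented_simplex_def restrict_def fun_eq_iff)
qed

lemma back_face_oriented_simplex:
  "back_face p q (oriented_simplex (p + q) l) = oriented_simplex q (\<lambda>j. l (p + j))"
proof -
  have "(\<Sum>j\<le>p + q. l j i * shift_simplex p x j) = (\<Sum>j\<le>q. l (p + j) i * x j)" for x i
  proof -
    have "(\<Sum>j\<le>p + q. l j i * shift_simplex p x j) = (\<Sum>j\<in>{p..p + q}. l j i * x (j - p))"
      by (rule sum.mono_neutral_cong_right) (auto simp: shift_simplex_def)
    also have "\<dots> = (\<Sum>j\<le>q. l (p + j) i * x j)"
      by (rule sum.reindex_bij_witness[of _ "\<lambda>i. p + i" "\<lambda>i. i - p"]) auto
    finally show ?thesis .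
  qed
  then show ?thesis
    using shift_in_standard_simplex[of _ q p]
    by (auto simp: back_face_shift oriented_simplex_def restrict_def fun_eq_iff)
qed

text \<open>On an affine simplex an iterated product of one-cochains is evaluated edge by edge along the
  path through the vertices.\<close>

lemma cup_cochains_oriented_simplex:
  assumes "singular_simplex (length as) X (oriented_simplex (length as) l)"
  shows "cup_cochains X as (oriented_simplex (length as) l)
       = (\<Prod>j<length as. (as ! j) (oriented_simplex 1 (\<lambda>i. l (j + i))))"
  using assms
proof (induction as arbitrary: l)
  case (Cons a as)
  have s: "singular_simplex (1 + length as) X (oriented_simplex (1 + length as) l)"
    using Cons.prems by simp
  have "singular_simplex (length as) X (oriented_simplex (length as) (\<lambda>j. l (1 + j)))"
    using singular_simplex_back_face[OF s] unfolding back_face_oriented_simplex .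
  from Cons.IH[OF this] have IH: "cup_cochains X as (oriented_simplex (length as) (\<lambda>j. l (1 + j)))
       = (\<Prod>j<length as. (as ! j) (oriented_simplex 1 (\<lambda>i. l (1 + (j + i)))))" .
  have "cup_cochains X (a # as) (oriented_simplex (1 + length as) l)
      = a (oriented_simplex 1 l) * cup_cochains X as (oriented_simplex (length as) (\<lambda>j. l (1 + j)))"
    unfolding cup_cochains.simps cochain_cup_def front_face_oriented_simplex back_face_oriented_simplex
    using s by simp
  then show ?case unfolding IH by (simp add: prod.lessThan_Suc_shift del: prod.lessThan_Suc)
qed simp

section \<open>Triangulated cells and cellular cochains\<close>

lemma list_sign_Nil: "list_sign [] = 1"
  by (simp add: list_sign_def)

lemma list_sign_Cons:
  "list_sign (x # xs) = (-1) ^ length (filter (\<lambda>y. y < x) xs) * list_sign xs"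
proof -
  let ?I = "\<lambda>xs. {(i, j). i < j \<and> j < length xs \<and> xs ! j < (xs ! i :: nat)}"
  let ?A = "(\<lambda>j. (0, Suc j)) ` {j. j < length xs \<and> xs ! j < x}"
  let ?B = "map_prod Suc Suc ` ?I xs"
  have "?I (x # xs) = ?A \<union> ?B"
  proof (rule equalityI; rule subsetI)
    fix z assume z: "z \<in> ?I (x # xs)"
    obtain i j where ij: "z = (i, j)" by (cases z)
    then obtain j' where "j = Suc j'" using z by (cases j) auto
    then show "z \<in> ?A \<union> ?B" using z ij by (cases i) (auto simp: image_iff)
  next
    fix z assume "z \<in> ?A \<union> ?B"
    then show "z \<in> ?I (x # xs)" by auto
  qed
  moreover have "finite (?I xs)" by (rule finite_subset[of _ "{..<length xs} \<times> {..<length xs}"]) auto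
  moreover have "card ?A = length (filter (\<lambda>y. y < x) xs)"
    by (subst card_image) (auto simp: inj_on_def length_filter_conv_card)
  moreover have "card ?B = card (?I xs)"
    by (subst card_image) (auto simp: inj_on_def)
  ultimately have "card (?I (x # xs)) = length (filter (\<lambda>y. y < x) xs) + card (?I xs)"
    using card_Un_disjoint[of ?A ?B] by force
  then show ?thesis by (simp add: list_sign_def power_add)
qed

lemma list_sign_swap:
  assumes "x \<noteq> y"
  shows "list_sign (us @ x # y # vs) = - list_sign (us @ y # x # vs)"
  using assms by (induction us) (auto simp: list_sign_Cons)

lemma list_sign_snoc:
  "list_sign (xs @ [x]) = (-1) ^ length (filter (\<lambda>y. x < y) xs) * list_sign xs"
  by (induction xs) (auto simp: list_sign_Cons list_sign_Nil power_add)

lemma list_sign_nonzero: "list_sign xs \<noteq> 0"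
  by (simp add: list_sign_def)

lemma sum_permutations_Cons:
  assumes "finite A" "A \<noteq> {}"
  shows "(\<Sum>xs\<in>permutations_of_set A. F xs) = (\<Sum>i\<in>A. \<Sum>ys\<in>permutations_of_set (A - {i}). F (i # ys))"
proof -
  have "(\<Sum>xs\<in>permutations_of_set A. F xs)
      = (\<Sum>i\<in>A. sum F ((#) i ` permutations_of_set (A - {i})))"
    unfolding permutations_of_set_nonempty[OF assms(2)]
    using assms by (intro sum.UNION_disjoint) auto
  also have "\<dots> = (\<Sum>i\<in>A. \<Sum>ys\<in>permutations_of_set (A - {i}). F (i # ys))"
    by (simp add: sum.reindex inj_on_def)
  finally show ?thesis .
qed

lemma sum_permutations_rev:
  "(\<Sum>xs\<in>permutations_of_set A. F (rev xs)) = (\<Sum>xs\<in>permutations_of_set A. F xs)"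
  by (rule sum.reindex_bij_witness[of _ rev rev]) (auto simp: permutations_of_set_def)

lemma sum_permutations_snoc:
  assumes "finite A" "A \<noteq> {}"
  shows "(\<Sum>xs\<in>permutations_of_set A. F xs) = (\<Sum>i\<in>A. \<Sum>ys\<in>permutations_of_set (A - {i}). F (ys @ [i]))"
proof -
  have "(\<Sum>xs\<in>permutations_of_set A. F xs) = (\<Sum>xs\<in>permutations_of_set A. F (rev xs))"
    by (rule sum_permutations_rev[symmetric])
  also have "\<dots> = (\<Sum>i\<in>A. \<Sum>ys\<in>permutations_of_set (A - {i}). F (rev ys @ [i]))"
    by (subst sum_permutations_Cons[OF assms]) simp
  also have "\<dots> = (\<Sum>i\<in>A. \<Sum>ys\<in>permutations_of_set (A - {i}). F (ys @ [i]))"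
    by (intro sum.cong refl sum_permutations_rev)
  finally show ?thesis .
qed

lemma length_filter_eq_card:
  "distinct xs \<Longrightarrow> length (filter P xs) = card {x \<in> set xs. P x}"
  by (metis distinct_card distinct_filter set_filter)

text \<open>The dimension \<open>q\<close> is independent of that of the cell, so that initial segments of a vertex
  sequence are covered too.\<close>

lemma singular_simplex_cell:
  assumes e: "e \<in> cells m K p"
  shows "singular_simplex q (real_moment_angle m K) (oriented_simplex q (cell_vertex e xs))"
proof -
  let ?S = "{x :: nat \<Rightarrow> real. \<forall>i\<ge>m. x i = 0} \<inter>
    (\<Union>\<sigma>\<in>K. {x. (\<forall>i<m. 0 \<le> x i \<and> x i \<le> 1) \<and> (\<forall>i<m. i \<notin> \<sigma> \<longrightarrow> x i \<in> {0, 1})})"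
  have "(\<lambda>i. \<Sum>j\<le>q. cell_vertex e xs j i * x j) \<in> ?S" if x: "x \<in> standard_simplex q" for x
  proof -
    let ?y = "\<lambda>i. \<Sum>j\<le>q. cell_vertex e xs j i * x j"
    have x1: "(\<Sum>j\<le>q. x j) = 1" and x0: "\<And>j. 0 \<le> x j" using x by (auto simp: standard_simplex_def)
    have v: "0 \<le> cell_vertex e xs j i" "cell_vertex e xs j i \<le> 1" for i j
      by (auto simp: cell_vertex_def split: interval_cell.split)
    have "0 \<le> ?y i" for i using v x0 by (intro sum_nonneg mult_nonneg_nonneg)
    moreover have "?y i \<le> 1" for i
      unfolding x1[symmetric] using v x0 by (intro sum_mono) (simp add: mult_left_le_one_le)
    moreover have "?y i \<in> {0, 1}" if "i \<notin> dirs e" for i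
      using that x1 by (cases "e i") (auto simp: cell_vertex_def dirs_def)
    moreover have "?y i = 0" if "i \<ge> m" for i
      using that e by (auto simp: cells_def cell_vertex_def)
    ultimately show ?thesis using e by (auto simp: cells_def)
  qed
  then have "simplicial_simplex q ?S (oriented_simplex q (cell_vertex e xs))"
    unfolding simplicial_simplex_oriented_simplex by blast
  then have "singular_simplex q (subtopology (powertop_real UNIV) ?S) (oriented_simplex q (cell_vertex e xs))"
    by (rule simplicial_imp_singular_simplex)
  then show ?thesis
    by (simp only: real_moment_angle_def Euclidean_space_def subtopology_subtopology)
qed

text \<open>The boundary of the triangulated cell is the triangulated boundary.  Omitting an interior vertex of
  the simplex of an ordering \<open>xs\<close> gives the same face as for the ordering with two adjacent
  directions exchanged, and these cancel because the signs of the orderings differ.  Omitting the first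
  vertex moves the cell to its upper side in the first direction of \<open>xs\<close>, and omitting the last
  one moves it to its lower side in the last direction.\<close>

lemma to_cellular_coboundary:
  assumes e: "e \<in> cells m K (Suc p)"
  shows "to_cellular (coboundary p (real_moment_angle m K) b) e = cell_coboundary (to_cellular b) e"
proof -
  let ?D = "dirs e" and ?n = "Suc p"
  let ?P = "permutations_of_set (dirs e)"
  let ?face = "\<lambda>k xs. b (oriented_simplex p (\<lambda>j. if j < k then cell_vertex e xs j else cell_vertex e xs (Suc j)))"
  have card: "card ?D = ?n" using e by (simp add: cells_def)
  then have fin: "finite ?D" and ne: "?D \<noteq> {}" by (auto intro: card_ge_0_finite)
  have len: "length xs = ?n" "distinct xs" "set xs = ?D" if "xs \<in> ?P" for xs
    using that card by (auto simp: permutations_of_set_def distinct_card[symmetric])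
  have cob: "coboundary p (real_moment_angle m K) b (oriented_simplex ?n (cell_vertex e xs))
      = (\<Sum>k\<le>?n. (-1) ^ k * ?face k xs)" for xs
    using singular_simplex_cell[OF e, of ?n xs]
    by (simp add: coboundary_def singular_face_oriented_simplex del: sum.atMost_Suc)
  define T where "T k = (\<Sum>xs\<in>?P. list_sign xs * ?face k xs)" for k
  have "to_cellular (coboundary p (real_moment_angle m K) b) e = (\<Sum>k\<le>?n. (-1) ^ k * T k)"
    unfolding to_cellular_def card cob T_def sum_distrib_left
    by (subst sum.swap) (simp only: mult.left_commute)
  also have "\<dots> = T 0 + (-1) ^ ?n * T ?n"
  proof -
    have "T k = 0" if k: "0 < k" "k < ?n" for k
    proof -
      \<comment> \<open>Exchanges the entries at positions \<open>k - 1\<close> and \<open>k\<close>, whose order affects the \<open>k\<close>th vertex only.\<close>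
      define swap where "swap xs = take (k - 1) xs @ [xs ! k, xs ! (k - 1)] @ drop (Suc k) xs" for xs :: "nat list"
      have split: "xs = take (k - 1) xs @ xs ! (k - 1) # xs ! k # drop (Suc k) xs" if "xs \<in> ?P" for xs
        using len(1)[OF that] k
        by (metis Cons_nth_drop_Suc Suc_diff_1 append_take_drop_id less_imp_diff_less)
      have sw: "swap (us @ x # y # vs) = us @ y # x # vs" if "length us = k - 1" for us vs and x y :: nat
        using that k by (auto simp: swap_def nth_append numeral_2_eq_2)
      have props: "swap xs \<in> ?P \<and> swap (swap xs) = xs \<and> list_sign (swap xs) * ?face k (swap xs) = - (list_sign xs * ?face k xs)"
        if xs: "xs \<in> ?P" for xs
      proof -
        define us where "us = take (k - 1) xs"
        define x where "x = xs ! (k - 1)"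
        define y where "y = xs ! k"
        define vs where "vs = drop (Suc k) xs"
        have xs_eq: "xs = us @ x # y # vs"
          unfolding us_def x_def y_def vs_def by (rule split[OF xs])
        have us: "length us = k - 1" using len(1)[OF xs] k by (simp add: us_def)
        have "x \<noteq> y" using len(2)[OF xs] xs_eq by auto
        have takes: "set (take j (us @ x # y # vs)) = set (take j (us @ y # x # vs))" if "j \<noteq> k" for j
        proof (cases "j < k")
          case False
          then have "j = length us + Suc (Suc (j - Suc k))" using that us k by linarith
          then obtain i where "j = length us + Suc (Suc i)" by blast
          then show ?thesis by auto
        qed (use us in auto)
        have "cell_vertex e (us @ x # y # vs) j = cell_vertex e (us @ y # x # vs) j" if "j \<noteq> k" for j
          unfolding cell_vertex_def takes[OF that] ..
        then have "(\<lambda>j. if j < k then cell_vertex e (us @ x # y # vs) j else cell_vertex e (us @ x # y # vs) (Suc j))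
          = (\<lambda>j. if j < k then cell_vertex e (us @ y # x # vs) j else cell_vertex e (us @ y # x # vs) (Suc j))"
          by auto
        then show ?thesis
          unfolding xs_eq sw[OF us] using xs list_sign_swap[OF \<open>x \<noteq> y\<close>, of us vs] xs_eq
          by (auto simp: permutations_of_set_def)
      qed
      define G where "G xs = list_sign xs * ?face k xs" for xs
      have swap: "swap xs \<in> ?P" "swap (swap xs) = xs" "G (swap xs) = - G xs" if "xs \<in> ?P" for xs
        using props[OF that] unfolding G_def by blast+
      have "sum G ?P = (\<Sum>xs\<in>?P. G (swap xs))"
        by (intro sum.reindex_bij_witness[of _ swap swap]) (simp_all add: swap(1,2))
      also have "\<dots> = (\<Sum>xs\<in>?P. - G xs)"
        by (rule sum.cong[OF refl]) (rule swap(3))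
      also have "\<dots> = - sum G ?P" by (rule sum_negf)
      finally show ?thesis by (simp add: T_def G_def)
    qed
    then have "(\<Sum>k\<le>?n. (-1) ^ k * T k) = (\<Sum>k\<in>{0, ?n}. (-1) ^ k * T k)"
      by (intro sum.mono_neutral_right) auto
    then show ?thesis by simp
  qed
  also have "T 0 = (\<Sum>i\<in>?D. (-1) ^ card {j \<in> ?D. j < i} * to_cellular b (e(i := Hi)))"
  proof -
    have "T 0 = (\<Sum>i\<in>?D. \<Sum>ys\<in>permutations_of_set (?D - {i}). list_sign (i # ys) * ?face 0 (i # ys))"
      unfolding T_def by (rule sum_permutations_Cons[OF fin ne])
    also have "\<dots> = (\<Sum>i\<in>?D. (-1) ^ card {j \<in> ?D. j < i} * to_cellular b (e(i := Hi)))"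
    proof (rule sum.cong[OF refl])
      fix i assume i: "i \<in> ?D"
      have d: "dirs (e(i := Hi)) = ?D - {i}" "card (?D - {i}) = p"
        using i card by (auto simp: dirs_def)
      show "(\<Sum>ys\<in>permutations_of_set (?D - {i}). list_sign (i # ys) * ?face 0 (i # ys))
          = (-1) ^ card {j \<in> ?D. j < i} * to_cellular b (e(i := Hi))"
        unfolding to_cellular_def d sum_distrib_left
      proof (rule sum.cong[OF refl])
        fix ys assume ys: "ys \<in> permutations_of_set (?D - {i})"
        then have "distinct ys" "set ys = ?D - {i}" by (auto simp: permutations_of_set_def)
        then have "length (filter (\<lambda>y. y < i) ys) = card {j \<in> ?D. j < i}"
          by (subst length_filter_eq_card) (auto intro!: arg_cong[of _ _ card])
        moreover have "cell_vertex e (i # ys) (Suc j) = cell_vertex (e(i := Hi)) ys j" for j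
          using i by (auto simp: cell_vertex_def dirs_def fun_eq_iff split: interval_cell.split)
        ultimately show "list_sign (i # ys) * ?face 0 (i # ys) = (-1) ^ card {j \<in> ?D. j < i}
            * (list_sign ys * b (oriented_simplex p (cell_vertex (e(i := Hi)) ys)))"
          by (simp add: list_sign_Cons)
      qed
    qed
    finally show ?thesis .
  qed
  also have "(-1) ^ ?n * T ?n = - (\<Sum>i\<in>?D. (-1) ^ card {j \<in> ?D. j < i} * to_cellular b (e(i := Lo)))"
  proof -
    have "(-1) ^ ?n * T ?n = (\<Sum>i\<in>?D. (-1) ^ ?n * (\<Sum>ys\<in>permutations_of_set (?D - {i}). list_sign (ys @ [i]) * ?face ?n (ys @ [i])))"
      unfolding T_def sum_distrib_left[symmetric] by (subst sum_permutations_snoc[OF fin ne]) (rule refl)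
    also have "\<dots> = (\<Sum>i\<in>?D. - ((-1) ^ card {j \<in> ?D. j < i} * to_cellular b (e(i := Lo))))"
    proof (rule sum.cong[OF refl])
      fix i assume i: "i \<in> ?D"
      have d: "dirs (e(i := Lo)) = ?D - {i}" "card (?D - {i}) = p"
        using i card by (auto simp: dirs_def)
      have "?D - {i} = {j \<in> ?D. j < i} \<union> {j \<in> ?D. i < j}" by auto
      moreover have "card ({j \<in> ?D. j < i} \<union> {j \<in> ?D. i < j}) = card {j \<in> ?D. j < i} + card {j \<in> ?D. i < j}"
      proof (rule card_Un_disjoint)
        show "finite {j \<in> ?D. j < i}" "finite {j \<in> ?D. i < j}"
          by (rule finite_subset[OF _ fin], blast)+
        show "{j \<in> ?D. j < i} \<inter> {j \<in> ?D. i < j} = {}"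
          unfolding disjoint_iff using less_not_sym by blast
      qed
      ultimately have "card (?D - {i}) = card {j \<in> ?D. j < i} + card {j \<in> ?D. i < j}" by simp
      then have p: "p = card {j \<in> ?D. j < i} + card {j \<in> ?D. i < j}" using d by simp
      have sgn: "(-1) ^ ?n * (-1) ^ card {j \<in> ?D. i < j} = - ((-1) ^ card {j \<in> ?D. j < i} :: rat)"
      proof -
        have "(-1) ^ ?n * (-1) ^ card {j \<in> ?D. i < j}
          = - ((-1) ^ card {j \<in> ?D. j < i} * ((-1) ^ card {j \<in> ?D. i < j} * (-1) ^ card {j \<in> ?D. i < j}) :: rat)"
          by (subst p) (simp add: power_add)
        then show ?thesis by (simp flip: power_mult_distrib)
      qed
      have "(\<Sum>ys\<in>permutations_of_set (?D - {i}). list_sign (ys @ [i]) * ?face ?n (ys @ [i]))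
          = (-1) ^ card {j \<in> ?D. i < j} * to_cellular b (e(i := Lo))"
        unfolding to_cellular_def d sum_distrib_left
      proof (rule sum.cong[OF refl])
        fix ys assume ys: "ys \<in> permutations_of_set (?D - {i})"
        then have y: "distinct ys" "set ys = ?D - {i}" by (auto simp: permutations_of_set_def)
        then have "length ys = p" using d by (metis distinct_card)
        have "length (filter (\<lambda>y. i < y) ys) = card {j \<in> ?D. i < j}"
          using y by (subst length_filter_eq_card) (auto intro!: arg_cong[of _ _ card])
        moreover have "cell_vertex e (ys @ [i]) j = cell_vertex (e(i := Lo)) ys j" if "j \<le> p" for j
          using i y that \<open>length ys = p\<close> in_set_takeD[of i j ys]
          by (auto simp: cell_vertex_def dirs_def fun_eq_iff split: interval_cell.split)
        then have "oriented_simplex p (\<lambda>j. if j < ?n then cell_vertex e (ys @ [i]) j else cell_vertex e (ys @ [i]) (Suc j))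
            = oriented_simplex p (cell_vertex (e(i := Lo)) ys)"
          unfolding oriented_simplex_eq by simp
        ultimately show "list_sign (ys @ [i]) * ?face ?n (ys @ [i]) = (-1) ^ card {j \<in> ?D. i < j}
            * (list_sign ys * b (oriented_simplex p (cell_vertex (e(i := Lo)) ys)))"
          by (simp add: list_sign_snoc)
      qed
      then show "(-1) ^ ?n * (\<Sum>ys\<in>permutations_of_set (?D - {i}). list_sign (ys @ [i]) * ?face ?n (ys @ [i]))
          = - ((-1) ^ card {j \<in> ?D. j < i} * to_cellular b (e(i := Lo)))"
        using sgn by (simp only: mult.assoc[symmetric] mult_minus_left)
    qed
    finally show ?thesis by (simp only: sum_negf)
  qed
  finally show ?thesis
    unfolding cell_coboundary_def right_diff_distrib sum_subtractf by (simp only: diff_conv_add_uminus)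
qed

section \<open>The top-dimensional cellular cycle\<close>

text \<open>The value of \<open>t_gen i\<close> at a vertex \<open>e\<close> is \<open>hi_sign (e i)\<close>.  The argument \<open>Edge\<close> is a junk case.\<close>

definition hi_sign :: "interval_cell \<Rightarrow> rat" where
  "hi_sign c = (if c = Hi then 1 else -1)"

lemma finite_cells_upto:
  "finite {e :: nat \<Rightarrow> interval_cell. \<forall>i\<ge>m. e i = Lo}"
proof -
  have "finite {e :: nat \<Rightarrow> interval_cell. \<forall>i. (i \<in> {..<m} \<longrightarrow> e i \<in> {Lo, Hi, Edge}) \<and> (i \<notin> {..<m} \<longrightarrow> e i = Lo)}"
    by (rule finite_set_of_finite_funs) auto
  moreover have "c \<in> {Lo, Hi, Edge}" for c by (cases c) auto
  ultimately show ?thesis by (auto simp: not_less elim!: rev_finite_subset)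
qed

lemma finite_cells: "finite (cells m K p)"
  by (rule finite_subset[OF _ finite_cells_upto[of m]]) (auto simp: cells_def)

definition cell_cycle :: "nat \<Rightarrow> (nat set \<Rightarrow> rat) \<Rightarrow> (nat \<Rightarrow> interval_cell) \<Rightarrow> rat" where
  "cell_cycle m \<epsilon> e = \<epsilon> (dirs e) * (\<Prod>i\<in>{..<m} - dirs e. hi_sign (e i))"

text \<open>Collecting the terms by the cell \<open>e\<close> of dimension \<open>p\<close> on which \<open>a\<close> is evaluated, the two ends of each
  edge direction contribute with the sign of the end, which completes the product of the signs
  of the fixed coordinates of \<open>e\<close>.  What is left as a factor is the coefficient of \<open>dirs e\<close> in the
  boundary of \<open>\<epsilon>\<close>.\<close>

lemma cell_cycle_coboundary:
  assumes K: "K \<subseteq> Pow {..<m}"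
    and cycle: "\<And>\<rho>. finite \<rho> \<Longrightarrow> card \<rho> = p \<Longrightarrow>
      (\<Sum>i\<in>{i. i \<notin> \<rho> \<and> insert i \<rho> \<in> K}. (-1) ^ card {j \<in> \<rho>. j < i} * \<epsilon> (insert i \<rho>)) = 0"
  shows "(\<Sum>e\<in>cells m K (Suc p). cell_cycle m \<epsilon> e * cell_coboundary a e) = 0"
proof -
  let ?C = "cells m K (Suc p)"
  let ?E = "{e. (\<forall>i\<ge>m. e i = Lo) \<and> dirs e \<subseteq> {..<m} \<and> card (dirs e) = p}"
  let ?I = "\<lambda>e. {i. i \<notin> dirs e \<and> insert i (dirs e) \<in> K}"
  let ?pos = "\<lambda>e i. (-1::rat) ^ card {j \<in> dirs e. j < i}"
  define F where "F e i = ?pos e i * \<epsilon> (insert i (dirs e)) * (\<Prod>l\<in>{..<m} - dirs e. hi_sign (e l)) * a e" for e i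
  have finD: "finite (dirs e)" if "e \<in> ?C \<or> e \<in> ?E" for e
    using that K finite_subset[of "dirs e" "{..<m}"] by (auto simp: cells_def)
  have finI: "finite (?I e)" for e
    by (rule finite_subset[of _ "{..<m}"]) (use K in auto)
  have finE: "finite ?E"
    by (rule finite_subset[OF _ finite_cells_upto[of m]]) auto
  have dupd: "dirs (e(i := c)) = dirs e - {i}" if "c \<noteq> Edge" for e i c
    using that by (auto simp: dirs_def)
  have edge: "dirs (e(i := Edge)) = insert i (dirs e)" for e i by (auto simp: dirs_def)
  have F_upd: "F (e(i := c)) i = hi_sign c * (cell_cycle m \<epsilon> e * ?pos e i * a (e(i := c)))"
    if e: "e \<in> ?C" and i: "i \<in> dirs e" and c: "c \<noteq> Edge" for e i c
  proof -
    have "i < m" using e i K by (auto simp: cells_def)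
    then have s: "{..<m} - (dirs e - {i}) = insert i ({..<m} - dirs e)" by auto
    have p: "{j \<in> dirs e - {i}. j < i} = {j \<in> dirs e. j < i}" by auto
    have "(\<Prod>l\<in>{..<m} - dirs e. hi_sign ((e(i := c)) l)) = (\<Prod>l\<in>{..<m} - dirs e. hi_sign (e l))"
      using i by (intro prod.cong) auto
    then have signs: "(\<Prod>l\<in>insert i ({..<m} - dirs e). hi_sign ((e(i := c)) l)) = hi_sign c * (\<Prod>l\<in>{..<m} - dirs e. hi_sign (e l))"
      using i by (subst prod.insert) auto
    then show ?thesis
      using i unfolding F_def dupd[OF c] s p cell_cycle_def signs by (simp add: insert_absorb)
  qed
  have "(\<Sum>e\<in>?C. cell_cycle m \<epsilon> e * cell_coboundary a e)
      = (\<Sum>e\<in>?C. \<Sum>i\<in>dirs e. \<Sum>c\<in>{Lo, Hi}. F (e(i := c)) i)"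
  proof (rule sum.cong[OF refl])
    fix e assume e: "e \<in> ?C"
    show "cell_cycle m \<epsilon> e * cell_coboundary a e = (\<Sum>i\<in>dirs e. \<Sum>c\<in>{Lo, Hi}. F (e(i := c)) i)"
      unfolding cell_coboundary_def sum_distrib_left
    proof (rule sum.cong[OF refl])
      fix i assume i: "i \<in> dirs e"
      show "cell_cycle m \<epsilon> e * (?pos e i * (a (e(i := Hi)) - a (e(i := Lo)))) = (\<Sum>c\<in>{Lo, Hi}. F (e(i := c)) i)"
        by (simp add: F_upd[OF e i] hi_sign_def algebra_simps)
    qed
  qed
  also have "\<dots> = (\<Sum>e\<in>?C. \<Sum>(i, c)\<in>dirs e \<times> {Lo, Hi}. F (e(i := c)) i)"
    by (simp only: sum.cartesian_product)
  also have "\<dots> = (\<Sum>(e, i, c)\<in>(SIGMA e:?C. dirs e \<times> {Lo, Hi}). F (e(i := c)) i)"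
    using finite_cells finD by (subst sum.Sigma) auto
  also have "\<dots> = (\<Sum>(e, i)\<in>(SIGMA e:?E. ?I e). F e i)"
  proof (rule sum.reindex_bij_witness[of _ "\<lambda>(e, i). (e(i := Edge), i, e i)" "\<lambda>(e, i, c). (e(i := c), i)"])
    fix x assume "x \<in> (SIGMA e:?C. dirs e \<times> {Lo, Hi})"
    then obtain e i c where x: "x = (e, i, c)" "e \<in> ?C" "i \<in> dirs e" "c \<noteq> Edge" by auto
    then have "e i = Edge" "i < m" using K by (auto simp: dirs_def cells_def)
    then show "(\<lambda>(e, i). (e(i := Edge), i, e i)) ((\<lambda>(e, i, c). (e(i := c), i)) x) = x"
      using x(1) by auto
    show "(\<lambda>(e, i, c). (e(i := c), i)) x \<in> (SIGMA e:?E. ?I e)"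
    proof -
      have "card (dirs e - {i}) = p" using x(2,3) by (simp add: cells_def)
      moreover have "dirs e \<subseteq> {..<m}" "dirs e \<in> K" "\<forall>j\<ge>m. e j = Lo"
        using x(2) K by (auto simp: cells_def)
      moreover have "insert i (dirs e - {i}) = dirs e" using x(3) by blast
      ultimately show ?thesis
        using \<open>i < m\<close> unfolding x(1) by (simp add: dupd[OF x(4)] subset_insertI2) blast
    qed
  next
    fix y assume "y \<in> (SIGMA e:?E. ?I e)"
    then obtain e i where y: "y = (e, i)" "e \<in> ?E" "i \<notin> dirs e" "insert i (dirs e) \<in> K" by auto
    then have "i < m" using K by auto
    have "e i \<in> {Lo, Hi}" using y(3) by (cases "e i") (auto simp: dirs_def)
    show "(\<lambda>(e, i). (e(i := Edge), i, e i)) y \<in> (SIGMA e:?C. dirs e \<times> {Lo, Hi})"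
    proof -
      have "card (insert i (dirs e)) = Suc p" using y(2,3) finD[of e] by simp
      moreover have "\<forall>j\<ge>m. e j = Lo" using y(2) by simp
      ultimately show ?thesis
        using y(4) \<open>i < m\<close> \<open>e i \<in> {Lo, Hi}\<close> unfolding y(1) by (auto simp: edge cells_def)
    qed
    show "(\<lambda>(e, i, c). (e(i := c), i)) ((\<lambda>(e, i). (e(i := Edge), i, e i)) y) = y" using y(1) by simp
  qed auto
  also have "\<dots> = (\<Sum>e\<in>?E. \<Sum>i\<in>?I e. F e i)"
    using finE finI by (subst sum.Sigma) auto
  also have "\<dots> = (\<Sum>e\<in>?E. (\<Sum>i\<in>?I e. ?pos e i * \<epsilon> (insert i (dirs e))) * ((\<Prod>l\<in>{..<m} - dirs e. hi_sign (e l)) * a e))"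
    unfolding F_def sum_distrib_right by (simp only: mult.assoc)
  also have "\<dots> = 0"
    using cycle finD by (intro sum.neutral ballI) auto
  finally show ?thesis .
qed

section \<open>Crossing cocycles\<close>

definition is_log_lift :: "(real \<Rightarrow> complex) \<Rightarrow> (real \<Rightarrow> complex) \<Rightarrow> bool" where
  "is_log_lift \<gamma> L \<longleftrightarrow> continuous_on {0..1} L \<and> (\<forall>t\<in>{0..1}. \<gamma> t = exp (L t))"

text \<open>The strips between consecutive integers correspond under \<open>exp\<close> to the plane slit along the
  positive real axis, so \<open>sheet\<close> jumps exactly when \<open>exp\<close> crosses that axis.\<close>

definition sheet :: "complex \<Rightarrow> int" where
  "sheet z = \<lfloor>Im z / (2 * pi)\<rfloor>"

text \<open>The signed number of times that a path in the punctured plane passes the positive real axis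
  counterclockwise, with endpoints on the axis counted as lying above it.\<close>

definition crossing_number :: "(real \<Rightarrow> complex) \<Rightarrow> int" where
  "crossing_number \<gamma> = (THE r. \<exists>L. is_log_lift \<gamma> L \<and> r = sheet (L 1) - sheet (L 0))"

text \<open>Two logarithms of a path differ by a continuous function with values in a discrete set.\<close>

lemma log_lift_unique:
  assumes "is_log_lift \<gamma> L" "is_log_lift \<gamma> M"
  shows "\<exists>k::int. \<forall>t\<in>{0..1}. L t = M t + of_int (2 * k) * of_real pi * \<i>"
proof -
  have int: "\<exists>k::int. L t - M t = of_int (2 * k) * of_real pi * \<i>" if "t \<in> {0..1}" for t
    using that assms exp_eq[of "L t" "M t"] by (auto simp: is_log_lift_def)
  have "(\<lambda>t. L t - M t) constant_on {0..1}"
  proof (rule continuous_discrete_range_constant)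
    show "continuous_on {0..1} (\<lambda>t. L t - M t)"
      using assms by (auto simp: is_log_lift_def intro: continuous_on_diff)
    fix x :: real assume x: "x \<in> {0..1}"
    have "1 \<le> norm ((L y - M y) - (L x - M x))" if y: "y \<in> {0..1}" "L y - M y \<noteq> L x - M x" for y
    proof -
      obtain k l :: int where kl: "L x - M x = of_int (2 * k) * of_real pi * \<i>" "L y - M y = of_int (2 * l) * of_real pi * \<i>"
        using int x y by blast
      then have "k \<noteq> l" using y by auto
      have e: "(L y - M y) - (L x - M x) = of_real (2 * pi * (real_of_int (l - k))) * \<i>"
        unfolding kl by (simp add: algebra_simps)
      have "1 \<le> \<bar>real_of_int (l - k)\<bar>" using \<open>k \<noteq> l\<close> by linarith
      moreover have "1 \<le> 2 * pi" using pi_gt3 by linarith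
      ultimately have "1 * 1 \<le> (2 * pi) * \<bar>real_of_int (l - k)\<bar>" by (intro mult_mono) auto
      then show ?thesis unfolding e norm_mult norm_of_real by (simp add: abs_mult)
    qed
    then show "\<exists>e>0. \<forall>y. y \<in> {0..1} \<and> L y - M y \<noteq> L x - M x \<longrightarrow> e \<le> norm ((L y - M y) - (L x - M x))"
      by (intro exI[of _ 1]) auto
  qed simp
  then obtain c where c: "\<forall>t\<in>{0..1}. L t - M t = c" by (auto simp: constant_on_def)
  moreover obtain k :: int where "L 0 - M 0 = of_int (2 * k) * of_real pi * \<i>" using int[of 0] by auto
  ultimately have "\<forall>t\<in>{0..1}. L t - M t = of_int (2 * k) * of_real pi * \<i>" by simp
  then show ?thesis by (metis add.commute diff_add_cancel)
qed

lemma sheet_shift: "sheet (z + of_int (2 * k) * of_real pi * \<i>) = sheet z + k"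
proof -
  have "Im (z + of_int (2 * k) * of_real pi * \<i>) / (2 * pi) = Im z / (2 * pi) + of_int k"
    by (simp add: add_divide_distrib)
  then show ?thesis unfolding sheet_def by (simp only: floor_add_int)
qed

lemma crossing_number_eq:
  assumes "is_log_lift \<gamma> L"
  shows "crossing_number \<gamma> = sheet (L 1) - sheet (L 0)"
  unfolding crossing_number_def
proof (rule the_equality)
  fix r assume "\<exists>L. is_log_lift \<gamma> L \<and> r = sheet (L 1) - sheet (L 0)"
  then obtain M where M: "is_log_lift \<gamma> M" "r = sheet (M 1) - sheet (M 0)" by blast
  obtain k where k: "\<forall>t\<in>{0..1}. M t = L t + of_int (2 * k) * of_real pi * \<i>"
    using log_lift_unique[OF M(1) assms] by blast
  then have "M 0 = L 0 + of_int (2 * k) * of_real pi * \<i>" "M 1 = L 1 + of_int (2 * k) * of_real pi * \<i>"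
    by simp_all
  then show "r = sheet (L 1) - sheet (L 0)" unfolding M(2) by (simp only: sheet_shift)
qed (use assms in blast)

lemma crossing_number_zero:
  assumes cont: "continuous_on {0..1} \<gamma>" and avoid: "\<And>t. t \<in> {0..1} \<Longrightarrow> \<gamma> t \<notin> \<real>\<^sub>\<ge>\<^sub>0"
  shows "crossing_number \<gamma> = 0"
proof -
  define L where "L t = Ln (- \<gamma> t) + of_real pi * \<i>" for t
  have neg: "- \<gamma> t \<notin> \<real>\<^sub>\<le>\<^sub>0" if "t \<in> {0..1}" for t
    using avoid[OF that] by (auto simp: complex_nonpos_Reals_iff complex_nonneg_Reals_iff)
  have "is_log_lift \<gamma> L"
    unfolding is_log_lift_def
  proof
    show "continuous_on {0..1} L"
      unfolding L_def by (intro continuous_intros cont neg)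
    show "\<forall>t\<in>{0..1}. \<gamma> t = exp (L t)"
    proof
      fix t :: real assume t: "t \<in> {0..1}"
      then have "\<gamma> t \<noteq> 0" using avoid[OF t] by auto
      then show "\<gamma> t = exp (L t)" by (simp add: L_def exp_add)
    qed
  qed
  moreover have "sheet (L t) = 0" if t: "t \<in> {0..1}" for t
  proof -
    have "- \<gamma> t \<noteq> 0" using avoid[OF t] by auto
    then have "- pi < Im (Ln (- \<gamma> t))" "Im (Ln (- \<gamma> t)) < pi"
      using mpi_less_Im_Ln Im_Ln_less_pi[OF neg[OF t]] by blast+
    then have "0 < Im (L t)" "Im (L t) < 2 * pi" by (auto simp: L_def)
    then show ?thesis unfolding sheet_def by (simp add: floor_eq_iff field_simps)
  qed
  ultimately show ?thesis using crossing_number_eq[of \<gamma> L] by simp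
qed

lemma crossing_number_one:
  assumes cont: "continuous_on {0..1} \<gamma>" and pos: "\<And>t. t \<in> {0..1} \<Longrightarrow> 0 < Re (\<gamma> t)"
    and ends: "Im (\<gamma> 0) < 0" "0 < Im (\<gamma> 1)"
  shows "crossing_number \<gamma> = 1"
proof -
  have dom: "\<gamma> t \<notin> \<real>\<^sub>\<le>\<^sub>0" "\<gamma> t \<noteq> 0" if "t \<in> {0..1}" for t
    using pos[OF that] by (auto simp: complex_nonpos_Reals_iff)
  have "is_log_lift \<gamma> (\<lambda>t. Ln (\<gamma> t))"
    unfolding is_log_lift_def using cont dom by (auto intro!: continuous_intros)
  moreover have "sheet (Ln (\<gamma> 1)) = 0"
    using Im_Ln_pos_lt_imp[OF ends(2)] unfolding sheet_def by (simp add: floor_eq_iff field_simps)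
  moreover have "sheet (Ln (\<gamma> 0)) = - 1"
  proof -
    have "\<gamma> 0 \<noteq> 0" using dom(2)[of 0] by simp
    then have "- pi < Im (Ln (\<gamma> 0))" "Im (Ln (\<gamma> 0)) < 0"
      using mpi_less_Im_Ln[of "\<gamma> 0"] Im_Ln_pos_le[of "\<gamma> 0"] Im_Ln_le_pi[of "\<gamma> 0"] ends(1) by force+
    then show ?thesis unfolding sheet_def by (simp add: floor_eq_iff field_simps)
  qed
  ultimately show ?thesis using crossing_number_eq[of \<gamma> "\<lambda>t. Ln (\<gamma> t)"] by simp
qed

definition edge_point :: "real \<Rightarrow> nat \<Rightarrow> real" where
  "edge_point t = (\<lambda>i. if i = 0 then 1 - t else if i = 1 then t else 0)"

text \<open>Unlike the change of the argument along a path, the crossing number is an integer, as is needed for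
  rational coefficients.\<close>

definition crossing_cochain :: "'b topology \<Rightarrow> ('b \<Rightarrow> complex) \<Rightarrow> 'b cochain" where
  "crossing_cochain X h = (\<lambda>f. if singular_simplex 1 X f
     then of_int (crossing_number (\<lambda>t. h (f (edge_point t)))) else 0)"

lemma edge_point_in_standard_simplex: "t \<in> {0..1} \<Longrightarrow> edge_point t \<in> standard_simplex 1"
  by (auto simp: standard_simplex_def edge_point_def)

lemma continuous_on_singular_simplex:
  fixes h :: "'b \<Rightarrow> complex" and q :: "'c::topological_space \<Rightarrow> nat \<Rightarrow> real"
  assumes f: "singular_simplex p X f" and h: "continuous_map X euclidean h"
    and q: "\<And>i. continuous_on T (\<lambda>z. q z i)" "\<And>z. z \<in> T \<Longrightarrow> q z \<in> standard_simplex p"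
  shows "continuous_on T (\<lambda>z. h (f (q z)))"
proof -
  have "continuous_map (top_of_set T) (subtopology (powertop_real UNIV) (standard_simplex p)) q"
    using q by (auto simp: continuous_map_in_subtopology continuous_map_componentwise)
  moreover have "continuous_map (subtopology (powertop_real UNIV) (standard_simplex p)) X f"
    using f by (simp add: singular_simplex_def)
  ultimately have "continuous_map (top_of_set T) euclidean (h \<circ> (f \<circ> q))"
    by (rule continuous_map_compose[OF continuous_map_compose h])
  then show ?thesis by (simp add: comp_def)
qed

text \<open>A singular triangle is contractible, so a logarithm exists on all of it.  The
  crossing numbers of the three edges are then differences of its sheets at the corners.\<close>

lemma crossing_cochain_cocycle:
  assumes h: "continuous_map X euclidean h" "\<And>x. x \<in> topspace X \<Longrightarrow> h x \<noteq> 0"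
  shows "crossing_cochain X h \<in> cocycles 1 X"
proof -
  have "coboundary 1 X (crossing_cochain X h) f = 0" for f
  proof (cases "singular_simplex 2 X f")
    case f: True
    define q :: "real \<times> real \<Rightarrow> nat \<Rightarrow> real"
      where "q z = (\<lambda>i. if i = 0 then 1 - fst z - snd z else if i = 1 then fst z else if i = 2 then snd z else 0)" for z
    define T :: "(real \<times> real) set" where "T = {z. 0 \<le> fst z \<and> 0 \<le> snd z \<and> fst z + snd z \<le> 1}"
    have qT: "q z \<in> standard_simplex 2" if "z \<in> T" for z
      using that by (auto simp: q_def T_def standard_simplex_def numeral_2_eq_2)
    have "continuous_on T (\<lambda>z. q z i)" for i
      unfolding q_def by (cases "i = 0 \<or> i = 1 \<or> i = 2") (auto intro!: continuous_intros)
    then have cont: "continuous_on T (\<lambda>z. h (f (q z)))"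
      using continuous_on_singular_simplex[OF f h(1)] qT by blast
    have "f \<in> standard_simplex 2 \<rightarrow> topspace X"
      using f by (auto simp: singular_simplex_def continuous_map_def)
    then have nz: "h (f (q z)) \<noteq> 0" if "z \<in> T" for z
      using h(2) qT[OF that] by blast
    have "convex T"
      unfolding T_def convex_def by (auto intro!: add_nonneg_nonneg)
        (metis (no_types, opaque_lifting) add_mono convex_bound_le distrib_left add.assoc add.left_commute)
    then have "contractible T" by (rule convex_imp_contractible)
    then obtain L where L: "continuous_on T L" "\<And>z. z \<in> T \<Longrightarrow> h (f (q z)) = exp (L z)"
      using continuous_logarithm_on_contractible[OF cont] nz by blast
    have face: "crossing_cochain X h (singular_face 2 k f) = of_int (sheet (L (c 1)) - sheet (L (c 0)))"
      if k: "k \<le> 2" and c: "continuous_on {0..1} c" "\<And>t. t \<in> {0..1} \<Longrightarrow> c t \<in> T"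
        "\<And>t. simplical_face k (edge_point t) = q (c t)" for k c
    proof -
      have s: "singular_simplex 1 X (singular_face 2 k f)"
        using singular_simplex_singular_face[OF f _ k] by simp
      have "singular_face 2 k f (edge_point t) = f (q (c t))" if "t \<in> {0..1}" for t
        using edge_point_in_standard_simplex[OF that] c(3) by (simp add: singular_face_def)
      then have "is_log_lift (\<lambda>t. h (singular_face 2 k f (edge_point t))) (\<lambda>t. L (c t))"
        unfolding is_log_lift_def using L(2) c(2) continuous_on_compose2[OF L(1) c(1)]
        by (simp add: image_subset_iff)
      from crossing_number_eq[OF this] show ?thesis using s by (simp add: crossing_cochain_def)
    qed
    have edges: "simplical_face 0 (edge_point t) = q (1 - t, t)"
      "simplical_face 1 (edge_point t) = q (0, t)" "simplical_face 2 (edge_point t) = q (t, 0)" for t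
      by (auto simp: q_def simplical_face_def edge_point_def fun_eq_iff)
    have "crossing_cochain X h (singular_face 2 0 f) = of_int (sheet (L (0, 1)) - sheet (L (1, 0)))"
    proof -
      have "continuous_on {0..1} (\<lambda>t::real. (1 - t, t))" by (intro continuous_intros)
      moreover have "(1 - t, t) \<in> T" if "t \<in> {0..1}" for t :: real using that by (auto simp: T_def)
      ultimately show ?thesis using face[of 0 "\<lambda>t. (1 - t, t)", OF _ _ _ edges(1)] by simp
    qed
    moreover have "crossing_cochain X h (singular_face 2 1 f) = of_int (sheet (L (0, 1)) - sheet (L (0, 0)))"
    proof -
      have "continuous_on {0..1} (\<lambda>t::real. (0, t))" by (intro continuous_intros)
      moreover have "(0, t) \<in> T" if "t \<in> {0..1}" for t :: real using that by (auto simp: T_def)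
      ultimately show ?thesis using face[of 1 "\<lambda>t. (0, t)", OF _ _ _ edges(2)] by simp
    qed
    moreover have "crossing_cochain X h (singular_face 2 2 f) = of_int (sheet (L (1, 0)) - sheet (L (0, 0)))"
    proof -
      have "continuous_on {0..1} (\<lambda>t::real. (t, 0))" by (intro continuous_intros)
      moreover have "(t, 0) \<in> T" if "t \<in> {0..1}" for t :: real using that by (auto simp: T_def)
      ultimately show ?thesis using face[of 2 "\<lambda>t. (t, 0)", OF _ _ _ edges(3)] by simp
    qed
    ultimately show ?thesis
      using f by (simp add: coboundary_def numeral_2_eq_2)
  qed (simp add: coboundary_def numeral_2_eq_2)
  then show ?thesis by (auto simp: cocycles_def cochains_def crossing_cochain_def)
qed

section \<open>The degree-one classes\<close>

definition sign_product :: "nat set \<Rightarrow> (nat \<Rightarrow> interval_cell) \<Rightarrow> rat" where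
  "sign_product B e = (\<Prod>i\<in>B. hi_sign (e i))"

lemma sign_product_cases: "sign_product B e = 1 \<or> sign_product B e = -1"
proof (cases "finite B")
  case True
  then show ?thesis by (induction B) (auto simp: sign_product_def hi_sign_def)
qed (simp add: sign_product_def)

lemma sign_product_cong: "(\<And>i. i \<in> B \<Longrightarrow> e i = e' i) \<Longrightarrow> sign_product B e = sign_product B e'"
  by (simp add: sign_product_def)

lemma u_mon_singleton: "u_mon {k} = u_gen k"
proof -
  have "u_mon {k} = cell_cup (u_gen k) cell_unit" by (simp add: u_mon_def)
  also have "\<dots> = u_gen k"
  proof
    fix e
    have "dirs (\<lambda>i. if i = k then Hi else e i) = dirs e - {k}" by (auto simp: dirs_def)
    then show "cell_cup (u_gen k) cell_unit e = u_gen k e"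
      by (subst cell_cup_supp[of "{k}" _ "{}"]) (auto simp: u_gen_def cell_unit_def)
  qed
  finally show ?thesis .
qed

lemma t_mon_eq:
  assumes "finite B"
  shows "t_mon B e = (if dirs e = {} then sign_product B e else 0)"
proof -
  have "foldr cell_cup (map t_gen xs) cell_unit e = (if dirs e = {} then \<Prod>i\<leftarrow>xs. hi_sign (e i) else 0)" for xs e
  proof (induction xs arbitrary: e)
    case (Cons x xs)
    let ?F = "foldr cell_cup (map t_gen xs) cell_unit"
    have supp: "\<forall>e. dirs e \<noteq> {} \<longrightarrow> t_gen x e = 0" "\<forall>e. dirs e \<noteq> {} \<longrightarrow> ?F e = 0"
      by (simp add: t_gen_def) (simp only: Cons.IH, simp)
    have "cell_cup (t_gen x) ?F e = (if dirs e = {} then t_gen x e * ?F e else 0)"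
      by (subst cell_cup_supp[OF supp]) simp_all
    also have "\<dots> = (if dirs e = {} then hi_sign (e x) * (\<Prod>i\<leftarrow>xs. hi_sign (e i)) else 0)"
      unfolding Cons.IH by (simp add: t_gen_def hi_sign_def)
    finally show ?case by simp
  qed (simp add: cell_unit_def)
  then have "t_mon B e = (if dirs e = {} then \<Prod>i\<leftarrow>sorted_list_of_set B. hi_sign (e i) else 0)"
    by (simp add: t_mon_def)
  then show ?thesis
    using prod.distinct_set_conv_list[OF distinct_sorted_list_of_set, of "\<lambda>i. hi_sign (e i)" B] assms
    by (simp add: sign_product_def)
qed

lemma u_t_product:
  assumes "finite B" "k \<notin> B"
  shows "cell_cup (u_mon {k}) (t_mon B) e = (if dirs e = {k} then 2 * sign_product B e else 0)"
proof -
  have supp: "\<forall>e. dirs e \<noteq> {k} \<longrightarrow> u_mon {k} e = 0" "\<forall>e. dirs e \<noteq> {} \<longrightarrow> t_mon B e = 0"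
    using t_mon_eq[OF assms(1)] by (auto simp: u_mon_singleton u_gen_def)
  have d: "dirs (\<lambda>i. if i = k then Hi else e i) = dirs e - {k}" by (auto simp: dirs_def)
  have s: "sign_product B (\<lambda>i. if i = k then Hi else e i) = sign_product B e"
    using assms(2) by (auto intro: sign_product_cong)
  show ?thesis
    using d s by (subst cell_cup_supp[OF supp]) (auto simp: u_mon_singleton u_gen_def t_mon_eq[OF assms(1)])
qed

lemma cell_coboundary_edge:
  assumes "dirs e = {i}"
  shows "cell_coboundary a e = a (e(i := Hi)) - a (e(i := Lo))"
proof -
  have empty: "{j. j = i \<and> j < i} = {}" by auto
  show ?thesis by (simp add: cell_coboundary_def assms empty)
qed

text \<open>When \<open>k\<close> has no neighbour in \<open>B\<close>, points of the real moment-angle complex cannot have both the \<open>k\<close>th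
  coordinate and a coordinate from \<open>B\<close> in the open interval, and this maps the complex to the
  boundary of a square around the origin.\<close>

definition loop_map :: "nat \<Rightarrow> nat set \<Rightarrow> (nat \<Rightarrow> real) \<Rightarrow> complex" where
  "loop_map k B x = Complex (\<Prod>i\<in>B. 2 * x i - 1) (2 * x k - 1)"

definition loop_cochain :: "nat \<Rightarrow> nat set set \<Rightarrow> nat \<Rightarrow> nat set \<Rightarrow> (nat \<Rightarrow> real) cochain" where
  "loop_cochain m K k B = crossing_cochain (real_moment_angle m K) (loop_map k B)"

text \<open>The vertex \<open>k\<close> is isolated in the full subcomplex on \<open>insert k B\<close>.\<close>

locale split_vertex_set =
  fixes m :: nat and K :: "nat set set" and k :: nat and B :: "nat set"
  assumes B: "B \<subseteq> {..<m}" and k: "k < m" "k \<notin> B" "{k} \<in> K"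
    and nonadjacent: "\<And>\<tau> j. \<tau> \<in> K \<Longrightarrow> k \<in> \<tau> \<Longrightarrow> j \<in> B \<Longrightarrow> j \<notin> \<tau>"
begin

lemma finite_B: "finite B"
  using B finite_subset by blast

lemma loop_cochain_cocycle: "loop_cochain m K k B \<in> cocycles 1 (real_moment_angle m K)"
  unfolding loop_cochain_def
proof (rule crossing_cochain_cocycle)
  have proj: "continuous_map (real_moment_angle m K) euclideanreal (\<lambda>x. x i)" for i
    unfolding real_moment_angle_def Euclidean_space_def
    by (intro continuous_map_from_subtopology continuous_map_product_projection) auto
  have "continuous_map (real_moment_angle m K) euclideanreal (\<lambda>x. \<Prod>i\<in>B. 2 * x i - 1)"
    using finite_B by (intro continuous_map_prod continuous_map_diff continuous_map_real_mult_left proj) auto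
  moreover have "continuous_map (real_moment_angle m K) euclideanreal (\<lambda>x. 2 * x k - 1)"
    by (intro continuous_map_diff continuous_map_real_mult_left proj) auto
  ultimately show "continuous_map (real_moment_angle m K) euclidean (loop_map k B)"
    unfolding loop_map_def[abs_def] continuous_map_atin by (auto intro: tendsto_Complex)
next
  fix x assume "x \<in> topspace (real_moment_angle m K)"
  then obtain \<tau> where \<tau>: "\<tau> \<in> K" "\<forall>i<m. i \<notin> \<tau> \<longrightarrow> x i \<in> {0, 1}"
    by (auto simp: real_moment_angle_def)
  show "loop_map k B x \<noteq> 0"
  proof (cases "k \<in> \<tau>")
    case True
    then have "2 * x i - 1 \<noteq> 0" if "i \<in> B" for i
      using \<tau>(2) nonadjacent[OF \<tau>(1) True that] B that by fastforce
    then show ?thesis using finite_B by (auto simp: loop_map_def complex_eq_iff)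
  next
    case False
    then have "2 * x k - 1 \<noteq> 0" using \<tau>(2) k(1) by fastforce
    then show ?thesis by (simp add: loop_map_def complex_eq_iff)
  qed
qed

text \<open>The image of an edge of the cube stays on one side of the square.  Only an edge in direction
  \<open>k\<close> over the right side passes the positive real axis.\<close>

lemma loop_cochain_edge:
  assumes f: "singular_simplex 1 (real_moment_angle m K) (oriented_simplex 1 w)"
    and w0: "\<And>i. w 0 i \<in> {0, 1}" and d: "w 0 d = 0" and w1: "w 1 = (w 0)(d := 1)"
  shows "loop_cochain m K k B (oriented_simplex 1 w)
    = (if d = k \<and> (\<Prod>i\<in>B. 2 * w 0 i - 1) = 1 then 1 else 0)"
proof -
  let ?\<gamma> = "\<lambda>t. loop_map k B (oriented_simplex 1 w (edge_point t))"
  have path: "oriented_simplex 1 w (edge_point t) i = (if i = d then t else w 0 i)" if "t \<in> {0..1}" for t i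
    using edge_point_in_standard_simplex[OF that] d
    by (auto simp: oriented_simplex_def edge_point_def w1[unfolded One_nat_def] algebra_simps)
  have cont: "continuous_on {0..1} ?\<gamma>"
  proof -
    have "continuous_on {0..1} (\<lambda>t. if i = d then t else w 0 i :: real)" for i
      by (cases "i = d") auto
    then have "continuous_on {0..1} (\<lambda>t. Complex (\<Prod>i\<in>B. 2 * (if i = d then t else w 0 i) - 1) (2 * (if k = d then t else w 0 k) - 1))"
      unfolding Complex_eq by (intro continuous_intros)
    then show ?thesis
      by (rule continuous_on_eq) (simp add: loop_map_def path del: One_nat_def)
  qed
  have evaluation: "loop_cochain m K k B (oriented_simplex 1 w) = of_int (crossing_number ?\<gamma>)"
    using f by (simp add: loop_cochain_def crossing_cochain_def del: One_nat_def)
  show ?thesis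
  proof (cases "d = k")
    case True
    have prod: "(\<Prod>i\<in>B. 2 * (if i = d then t else w 0 i) - 1) = (\<Prod>i\<in>B. 2 * w 0 i - 1)" for t
      using k(2) True by (intro prod.cong) auto
    have \<gamma>: "?\<gamma> t = Complex (\<Prod>i\<in>B. 2 * w 0 i - 1) (2 * t - 1)" if "t \<in> {0..1}" for t
      using that prod[unfolded True] by (simp add: loop_map_def path True del: One_nat_def)
    have "\<bar>\<Prod>i\<in>B. 2 * w 0 i - 1\<bar> = (\<Prod>i\<in>B. \<bar>2 * w 0 i - 1\<bar>)" by (rule abs_prod)
    also have "\<dots> = 1"
    proof (rule prod.neutral, rule ballI)
      show "\<bar>2 * w 0 i - 1\<bar> = 1" for i using w0[of i] by auto
    qed
    finally have "\<bar>\<Prod>i\<in>B. 2 * w 0 i - 1\<bar> = 1" .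
    then consider "(\<Prod>i\<in>B. 2 * w 0 i - 1) = 1" | "(\<Prod>i\<in>B. 2 * w 0 i - 1) = -1" by linarith
    then show ?thesis
    proof cases
      case 1
      then have "crossing_number ?\<gamma> = 1"
        using \<gamma> by (intro crossing_number_one cont) simp_all
      then show ?thesis using evaluation True 1 by (simp del: One_nat_def)
    next
      case 2
      then have "crossing_number ?\<gamma> = 0"
        using \<gamma> by (intro crossing_number_zero cont) (simp add: complex_nonneg_Reals_iff)
      then show ?thesis using evaluation 2 by (simp del: One_nat_def)
    qed
  next
    case False
    have "Im (?\<gamma> t) \<noteq> 0" if "t \<in> {0..1}" for t
      using w0[of k] False path[OF that, of k] by (auto simp: loop_map_def simp del: One_nat_def)
    then have "crossing_number ?\<gamma> = 0"
      by (intro crossing_number_zero cont) (auto simp: complex_nonneg_Reals_iff)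
    then show ?thesis using evaluation False by (simp del: One_nat_def)
  qed
qed

lemma loop_cochain_cell_edge:
  assumes e: "e \<in> cells m K p" and xs: "xs \<in> permutations_of_set (dirs e)" and j: "j < p"
    and B0: "xs ! j = k \<Longrightarrow> B \<inter> dirs e = {}"
  shows "loop_cochain m K k B (oriented_simplex 1 (\<lambda>i. cell_vertex e xs (j + i)))
    = (if xs ! j = k \<and> sign_product B e = 1 then 1 else 0)"
proof -
  have xs': "length xs = p" "distinct xs" "set xs = dirs e"
    using xs e by (auto simp: permutations_of_set_def cells_def distinct_card[symmetric])
  then have d: "xs ! j \<in> dirs e" using j nth_mem by metis
  have nt: "xs ! j \<notin> set (take j xs)"
    using xs' j by (auto simp: in_set_conv_nth nth_eq_iff_index_eq)
  have s: "singular_simplex (j + 1) (real_moment_angle m K) (oriented_simplex (j + 1) (cell_vertex e xs))"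
    by (rule singular_simplex_cell[OF e])
  have "singular_simplex 1 (real_moment_angle m K) (oriented_simplex 1 (\<lambda>i. cell_vertex e xs (j + i)))"
    using singular_simplex_back_face[OF s] by (simp only: back_face_oriented_simplex)
  moreover have "cell_vertex e xs (j + 0) i \<in> {0, 1}" for i
    by (auto simp: cell_vertex_def split: interval_cell.split)
  moreover have "cell_vertex e xs (j + 0) (xs ! j) = 0"
    using d nt by (auto simp: cell_vertex_def dirs_def)
  moreover have "cell_vertex e xs (j + 1) = (cell_vertex e xs (j + 0))(xs ! j := 1)"
    using d xs'(1) j by (auto simp: cell_vertex_def dirs_def take_Suc_conv_app_nth fun_eq_iff split: interval_cell.split)
  ultimately have "loop_cochain m K k B (oriented_simplex 1 (\<lambda>i. cell_vertex e xs (j + i)))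
    = (if xs ! j = k \<and> (\<Prod>i\<in>B. 2 * cell_vertex e xs (j + 0) i - 1) = 1 then 1 else 0)"
    by (rule loop_cochain_edge)
  moreover have "(\<Prod>i\<in>B. 2 * cell_vertex e xs (j + 0) i - 1) = of_rat (sign_product B e)" if "xs ! j = k"
  proof -
    have "2 * cell_vertex e xs (j + 0) i - 1 = of_rat (hi_sign (e i))" if "i \<in> B" for i
      using B0[OF \<open>xs ! j = k\<close>] that by (cases "e i") (auto simp: cell_vertex_def hi_sign_def dirs_def)
    then show ?thesis by (simp add: sign_product_def of_rat_prod)
  qed
  ultimately show ?thesis by (auto simp: of_rat_eq_1_iff)
qed

text \<open>On a one-cell in direction \<open>k\<close> the cochain is \<open>(1 + s) / 2\<close>, where \<open>s\<close> is the sign product over \<open>B\<close>.  The constant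
  part \<open>1 / 2\<close> is the coboundary of half the \<open>k\<close>th coordinate, and \<open>s / 2\<close> is a quarter of \<open>u\<^sub>k t\<^sub>B\<close> because \<open>u_gen\<close>
  carries the factor \<open>2\<close>.\<close>

lemma loop_class_graded:
  "cohomologous 1 (real_moment_angle m K) `` {loop_cochain m K k B}
    \<in> graded_cohomology m K 1 (insert k B)"
proof -
  let ?X = "real_moment_angle m K" and ?a = "loop_cochain m K k B"
  define z where "z e = (1 / 4) * cell_cup (u_mon {k}) (t_mon B) e" for e
  have z: "z e = (if dirs e = {k} then sign_product B e / 2 else 0)" for e
    unfolding z_def by (simp add: u_t_product[OF finite_B k(2)])
  have nb: "B \<inter> dirs e = {}" if "dirs e \<in> K" "k \<in> dirs e" for e
    using nonadjacent[OF that] by blast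
  have "z \<in> RK K (insert k B) 1"
  proof -
    let ?S = "{\<sigma> \<in> K. \<sigma> \<subseteq> insert k B \<and> card \<sigma> = 1}"
    have "?S \<subseteq> Pow (insert k B)" by blast
    then have "finite ?S" using finite_B finite_subset by (metis finite_Pow_iff finite_insert)
    moreover have "{k} \<in> ?S" using k(3) by simp
    moreover have "insert k B - {k} = B" using k(2) by blast
    ultimately have "z e = (\<Sum>\<sigma>\<in>?S. (if \<sigma> = {k} then 1 / 4 else 0) * cell_cup (u_mon \<sigma>) (t_mon (insert k B - \<sigma>)) e)" for e
      unfolding z_def by (subst sum.remove[of _ "{k}"]) (auto intro!: sum.neutral)
    then have "z = (\<lambda>e. \<Sum>\<sigma>\<in>?S. (if \<sigma> = {k} then 1 / 4 else 0) * cell_cup (u_mon \<sigma>) (t_mon (insert k B - \<sigma>)) e)"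
      by blast
    then show ?thesis unfolding RK_def by (intro CollectI exI[of _ "\<lambda>\<sigma>. if \<sigma> = {k} then 1 / 4 else 0"]) simp
  qed
  moreover have "cell_coboundary z e = 0" if e: "e \<in> cells m K (Suc 1)" for e
    unfolding cell_coboundary_def
  proof (rule sum.neutral, rule ballI)
    fix i assume i: "i \<in> dirs e"
    have d: "dirs (e(i := Hi)) = dirs e - {i}" "dirs (e(i := Lo)) = dirs e - {i}" by (auto simp: dirs_def)
    have "z (e(i := Hi)) = z (e(i := Lo))"
    proof (cases "dirs e - {i} = {k}")
      case True
      then have "i \<notin> B" using nb[of e] e i by (auto simp: cells_def)
      then have "sign_product B (e(i := Hi)) = sign_product B (e(i := Lo))"
        by (intro sign_product_cong) auto
      then show ?thesis using d by (simp add: z)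
    qed (use d in \<open>simp add: z\<close>)
    then show "(-1) ^ card {j \<in> dirs e. j < i} * (z (e(i := Hi)) - z (e(i := Lo))) = 0" by simp
  qed
  ultimately have zc: "z \<in> RK_cocycles m K (insert k B) 1" by (simp add: RK_cocycles_def)
  have cell: "cell_cohomologous m K 1 (to_cellular a) z" if a: "a \<in> cohomologous 1 ?X `` {?a}" for a
  proof -
    have "(?a, a) \<in> cohomologous 1 ?X" using a by simp
    then have "(\<lambda>f. ?a f - a f) \<in> coboundaries 1 ?X" by (simp add: cohomologous_def)
    then obtain b where b: "(\<lambda>f. ?a f - a f) = coboundary 0 ?X b" by (auto simp: coboundaries_def)
    define w where "w e = (if dirs e = {} \<and> e k = Hi then 1 / 2 else 0) - to_cellular b e" for e
    have "to_cellular a e - z e = cell_coboundary w e" if e: "e \<in> cells m K 1" for e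
    proof -
      have "card (dirs e) = 1" using e by (simp add: cells_def)
      then obtain i where i: "dirs e = {i}" by (auto simp: card_1_singleton_iff)
      have perm: "permutations_of_set (dirs e) = {[i]}" unfolding i by (simp add: permutations_of_set_singleton)
      have "to_cellular (coboundary 0 ?X b) e = cell_coboundary (to_cellular b) e"
        using to_cellular_coboundary[of e m K 0 b] e by simp
      moreover have "to_cellular (coboundary 0 ?X b) e = to_cellular ?a e - to_cellular a e"
        unfolding b[symmetric] by (simp add: to_cellular_def right_diff_distrib sum_subtractf)
      ultimately have ta: "to_cellular a e = to_cellular ?a e - cell_coboundary (to_cellular b) e" by simp
      have disj: "B \<inter> dirs e = {}" if "[i] ! 0 = k"
      proof -
        have "dirs e \<in> K" using e by (simp add: cells_def)
        moreover have "k \<in> dirs e" using that i by simp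
        ultimately show ?thesis by (rule nb)
      qed
      have "to_cellular ?a e = ?a (oriented_simplex 1 (cell_vertex e [i]))"
        unfolding to_cellular_def perm by (simp add: i list_sign_Cons list_sign_Nil)
      also have "\<dots> = (if i = k \<and> sign_product B e = 1 then 1 else 0)"
      proof -
        have "?a (oriented_simplex 1 (\<lambda>l. cell_vertex e [i] (0 + l)))
          = (if [i] ! 0 = k \<and> sign_product B e = 1 then 1 else 0)"
          by (rule loop_cochain_cell_edge[OF e _ _ disj]) (simp_all add: perm)
        then show ?thesis by (simp del: One_nat_def)
      qed
      finally have "to_cellular ?a e - z e = (if i = k then 1 / 2 else 0)"
        using sign_product_cases[of B e] by (auto simp: z i)
      moreover have "cell_coboundary w e = (if i = k then 1 / 2 else 0) - cell_coboundary (to_cellular b) e"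
      proof -
        have "dirs (e(i := Hi)) = {}" "dirs (e(i := Lo)) = {}" using i by (auto simp: dirs_def)
        then show ?thesis by (simp add: cell_coboundary_edge[OF i] w_def)
      qed
      ultimately show ?thesis using ta by simp
    qed
    then show ?thesis unfolding cell_cohomologous_def by blast
  qed
  have "cohomologous 1 ?X `` {?a} \<in> cohomology 1 ?X"
    unfolding cohomology_def by (rule quotientI[OF loop_cochain_cocycle])
  then show ?thesis unfolding graded_cohomology_def using zc cell by blast
qed
section \<open>Collapsing onto a cross-polytope\<close>

end

lemma foldr_sym_diff_partition:
  "distinct ks \<Longrightarrow> foldr sym_diff (map (\<lambda>k. {j \<in> A. g j = k}) ks) {} = {j \<in> A. g j \<in> set ks}"
  by (induction ks) auto

text \<open>The nonvanishing criterion, for any complex that carries a top-dimensional cycle \<open>\<epsilon>\<close>.  The map \<open>g\<close> encodes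
  a simplicial map to the boundary of a cross-polytope for which \<open>\<sigma>\<close> is the only face over its
  image.\<close>

lemma almost_c_symplectic_if_retraction:
  assumes K: "K \<subseteq> Pow {..<m}" and \<sigma>: "\<sigma> \<in> K" "card \<sigma> = Suc p"
    and vertices: "\<And>k. k \<in> \<sigma> \<Longrightarrow> {k} \<in> K"
    and g: "\<And>j. j < m \<Longrightarrow> g j \<in> \<sigma>" "\<And>k. k \<in> \<sigma> \<Longrightarrow> g k = k"
    and nonadjacent: "\<And>\<tau> j. \<tau> \<in> K \<Longrightarrow> j \<in> \<tau> \<Longrightarrow> j \<notin> \<sigma> \<Longrightarrow> g j \<notin> \<tau>"
    and \<epsilon>: "\<epsilon> \<sigma> \<noteq> (0::rat)"
    and cycle: "\<And>\<rho>. finite \<rho> \<Longrightarrow> card \<rho> = p \<Longrightarrow>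
      (\<Sum>i\<in>{i. i \<notin> \<rho> \<and> insert i \<rho> \<in> K}. (-1) ^ card {j \<in> \<rho>. j < i} * \<epsilon> (insert i \<rho>)) = 0"
  shows "almost_c_symplectic m K"
proof -
  let ?X = "real_moment_angle m K" and ?n = "Suc p"
  define ks where "ks = sorted_list_of_set \<sigma>"
  have sub: "\<sigma> \<subseteq> {..<m}" using K \<sigma>(1) by blast
  then have fin: "finite \<sigma>" using finite_subset by blast
  have ks: "distinct ks" "set ks = \<sigma>" "length ks = ?n"
    using fin \<sigma>(2) by (simp_all add: ks_def)
  define \<omega> where "\<omega> k = {j \<in> {..<m}. g j = k}" for k
  define B where "B k = \<omega> k - {k}" for k
  have \<omega>: "\<omega> k = insert k (B k)" if "k \<in> \<sigma>" for k
    using that sub g(2) by (auto simp: \<omega>_def B_def)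
  have B\<sigma>: "B k = {j \<in> {..<m} - \<sigma>. g j = k}" if "k \<in> \<sigma>" for k
    using that g(2) by (auto simp: \<omega>_def B_def)
  have split: "split_vertex_set m K k (B k)" if k: "k \<in> \<sigma>" for k
  proof
    show "j \<notin> \<tau>" if "\<tau> \<in> K" "k \<in> \<tau>" "j \<in> B k" for \<tau> j
      using nonadjacent[OF that(1), of j] that B\<sigma>[OF k] by auto
  qed (use k sub vertices B\<sigma> in auto)
  define a where "a k = loop_cochain m K k (B k)" for k
  define as where "as = map a ks"
  have as: "set as \<subseteq> cocycles 1 ?X" "length as = ?n"
    using split_vertex_set.loop_cochain_cocycle[OF split] ks by (auto simp: as_def a_def)
  let ?cls = "\<lambda>k. cohomologous 1 ?X `` {a k}"
  define ts where "ts = map (\<lambda>k. (1::nat, \<omega> k, ?cls k)) ks"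
  let ?c = "cup_cochains ?X as"
  have evaluation: "to_cellular ?c e = (if dirs e = \<sigma> then list_sign ks * (\<Prod>k\<in>\<sigma>. if sign_product (B k) e = 1 then 1 else 0) else 0)"
    if e: "e \<in> cells m K ?n" for e
  proof -
    have "card (dirs e) = ?n" "dirs e \<in> K" using e by (simp_all add: cells_def)
    have disj: "B k \<inter> dirs e = {}" if "k \<in> \<sigma>" "k \<in> dirs e" for k
      using split_vertex_set.nonadjacent[OF split[OF that(1)] \<open>dirs e \<in> K\<close> that(2)] by blast
    have eval: "?c (oriented_simplex ?n (cell_vertex e xs))
        = (\<Prod>j<?n. if xs ! j = ks ! j \<and> sign_product (B (ks ! j)) e = 1 then 1 else 0)"
      if xs: "xs \<in> permutations_of_set (dirs e)" for xs
    proof -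
      have "?c (oriented_simplex ?n (cell_vertex e xs))
          = (\<Prod>j<?n. (as ! j) (oriented_simplex 1 (\<lambda>i. cell_vertex e xs (j + i))))"
        using cup_cochains_oriented_simplex[of as ?X "cell_vertex e xs"] singular_simplex_cell[OF e] as(2) by simp
      also have "\<dots> = (\<Prod>j<?n. if xs ! j = ks ! j \<and> sign_product (B (ks ! j)) e = 1 then 1 else 0)"
      proof (rule prod.cong[OF refl])
        fix j assume "j \<in> {..<?n}"
        then have j: "j < ?n" by simp
        have kj: "ks ! j \<in> \<sigma>" using ks j nth_mem by metis
        have "xs ! j \<in> dirs e"
        proof -
          have "length xs = ?n" "set xs = dirs e"
            using xs \<open>card (dirs e) = ?n\<close> by (auto simp: permutations_of_set_def distinct_card[symmetric])
          then show ?thesis using j nth_mem by metis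
        qed
        then have "B (ks ! j) \<inter> dirs e = {}" if "xs ! j = ks ! j" using disj[OF kj] that by simp
        moreover have "as ! j = loop_cochain m K (ks ! j) (B (ks ! j))"
          using ks(3) j by (simp add: as_def a_def)
        ultimately show "(as ! j) (oriented_simplex 1 (\<lambda>i. cell_vertex e xs (j + i)))
            = (if xs ! j = ks ! j \<and> sign_product (B (ks ! j)) e = 1 then 1 else 0)"
          using split_vertex_set.loop_cochain_cell_edge[OF split[OF kj] e xs j] by (simp only:)
      qed
      finally show ?thesis .
    qed
    have zero: "?c (oriented_simplex ?n (cell_vertex e xs)) = 0"
      if xs: "xs \<in> permutations_of_set (dirs e)" "xs \<noteq> ks" for xs
    proof -
      have "length xs = ?n"
        using xs \<open>card (dirs e) = ?n\<close> by (auto simp: permutations_of_set_def distinct_card[symmetric])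
      then obtain j where "j < ?n" "xs ! j \<noteq> ks ! j" using xs(2) ks(3) nth_equalityI[of xs ks] by metis
      then show ?thesis unfolding eval[OF xs(1)] by (intro prod_zero) auto
    qed
    show ?thesis
    proof (cases "dirs e = \<sigma>")
      case True
      then have mem: "ks \<in> permutations_of_set (dirs e)" using ks by (auto simp: permutations_of_set_def)
      have "to_cellular ?c e = list_sign ks * ?c (oriented_simplex ?n (cell_vertex e ks))"
        unfolding to_cellular_def \<open>card (dirs e) = ?n\<close>
        using zero by (subst sum.remove[OF _ mem]) (auto intro!: sum.neutral)
      also have "?c (oriented_simplex ?n (cell_vertex e ks)) = (\<Prod>j<?n. if sign_product (B (ks ! j)) e = 1 then 1 else 0)"
        unfolding eval[OF mem] by simp
      also have "\<dots> = (\<Prod>k\<in>\<sigma>. if sign_product (B k) e = 1 then 1 else 0)"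
        by (rule prod.reindex_bij_betw) (use bij_betw_nth[OF ks(1)] ks in simp)
      finally show ?thesis using True by simp
    next
      case False
      then have "ks \<notin> permutations_of_set (dirs e)" using ks by (auto simp: permutations_of_set_def)
      then have "\<And>xs. xs \<in> permutations_of_set (dirs e) \<Longrightarrow> ?c (oriented_simplex ?n (cell_vertex e xs)) = 0"
        using zero by metis
      then show ?thesis using False unfolding to_cellular_def \<open>card (dirs e) = ?n\<close> by simp
    qed
  qed
  \<comment> \<open>The cell over \<open>\<sigma>\<close> all of whose fixed coordinates are \<open>1\<close>.\<close>
  define e0 where "e0 i = (if i \<in> \<sigma> then Edge else if i < m then Hi else Lo)" for i
  have dirs_e0: "dirs e0 = \<sigma>" by (auto simp: dirs_def e0_def)
  have e0_Lo: "e0 i = Lo" if "m \<le> i" for i using that sub by (auto simp: e0_def)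
  have "e0 \<in> cells m K ?n"
    unfolding cells_def mem_Collect_eq dirs_e0 using \<sigma> e0_Lo by simp
  moreover have "sign_product (B k) e0 = 1" if "k \<in> \<sigma>" for k
    unfolding sign_product_def using B\<sigma>[OF that] by (intro prod.neutral) (auto simp: e0_def hi_sign_def)
  ultimately have e0: "e0 \<in> {e \<in> cells m K ?n. dirs e = \<sigma> \<and> (\<forall>k\<in>\<sigma>. sign_product (B k) e = 1)}"
    using dirs_e0 by blast
  \<comment> \<open>Pairing with the cellular cycle: all nonzero terms are equal, and \<open>e0\<close> contributes one.\<close>
  have not_coboundary: "?c \<noteq> coboundary p ?X b" for b
  proof
    assume c: "?c = coboundary p ?X b"
    have "0 = (\<Sum>e\<in>cells m K ?n. cell_cycle m \<epsilon> e * cell_coboundary (to_cellular b) e)"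
      by (rule cell_cycle_coboundary[OF K, symmetric]) (rule cycle)
    also have "\<dots> = (\<Sum>e\<in>cells m K ?n. cell_cycle m \<epsilon> e * to_cellular ?c e)"
      by (rule sum.cong[OF refl]) (simp add: c to_cellular_coboundary)
    also have "\<dots> = (\<Sum>e\<in>cells m K ?n. \<epsilon> \<sigma> * list_sign ks *
        (if dirs e = \<sigma> \<and> (\<forall>k\<in>\<sigma>. sign_product (B k) e = 1) then 1 else 0))"
    proof (rule sum.cong[OF refl])
      fix e assume e: "e \<in> cells m K ?n"
      have "sign_product ({..<m} - \<sigma>) e = (\<Prod>k\<in>\<sigma>. sign_product (B k) e)"
      proof -
        have "(\<Prod>k\<in>\<sigma>. sign_product (B k) e) = (\<Prod>k\<in>\<sigma>. \<Prod>i\<in>{j \<in> {..<m} - \<sigma>. g j = k}. hi_sign (e i))"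
          by (rule prod.cong[OF refl]) (simp only: sign_product_def B\<sigma>)
        also have "\<dots> = (\<Prod>i\<in>{..<m} - \<sigma>. hi_sign (e i))"
          by (rule prod.group) (use fin g(1) in auto)
        finally show ?thesis by (simp only: sign_product_def)
      qed
      then have "(\<forall>k\<in>\<sigma>. sign_product (B k) e = 1) \<Longrightarrow> sign_product ({..<m} - \<sigma>) e = 1" by simp
      moreover have "(\<Prod>k\<in>\<sigma>. if sign_product (B k) e = 1 then 1 else 0 :: rat)
          = (if \<forall>k\<in>\<sigma>. sign_product (B k) e = 1 then 1 else 0)"
        using fin by auto
      ultimately show "cell_cycle m \<epsilon> e * to_cellular ?c e = \<epsilon> \<sigma> * list_sign ks *
        (if dirs e = \<sigma> \<and> (\<forall>k\<in>\<sigma>. sign_product (B k) e = 1) then 1 else 0)"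
        unfolding evaluation[OF e] cell_cycle_def sign_product_def[symmetric] by simp
    qed
    also have "\<dots> = \<epsilon> \<sigma> * list_sign ks *
        of_nat (card {e \<in> cells m K ?n. dirs e = \<sigma> \<and> (\<forall>k\<in>\<sigma>. sign_product (B k) e = 1)})"
      unfolding sum_distrib_left[symmetric] sum.inter_filter[OF finite_cells, symmetric] by simp
    finally have "card {e \<in> cells m K ?n. dirs e = \<sigma> \<and> (\<forall>k\<in>\<sigma>. sign_product (B k) e = 1)} = 0"
      using \<epsilon> list_sign_nonzero[of ks] by simp
    then show False using e0 finite_cells[of m K ?n] by auto
  qed
  have deg: "sum_list (map fst ts) = ?n" using ks(3) by (simp add: ts_def comp_def sum_list_triv)
  have pairs: "map (\<lambda>(d, \<omega>, A). (d, A)) ts = map (\<lambda>a. (1, cohomologous 1 ?X `` {a})) as"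
    by (simp add: ts_def as_def)
  have "cup_list ?X (map (\<lambda>(d, \<omega>, A). (d, A)) ts) \<noteq> zero_class (sum_list (map fst ts)) ?X"
  proof
    assume "cup_list ?X (map (\<lambda>(d, \<omega>, A). (d, A)) ts) = zero_class (sum_list (map fst ts)) ?X"
    then have "?c \<in> zero_class ?n ?X"
      using cup_cochains_in_cup_list[OF as(1)] unfolding pairs deg by simp
    then have "(\<lambda>f. 0 - ?c f) \<in> coboundaries ?n ?X" by (simp add: zero_class_def cohomologous_def)
    then obtain b where b: "(\<lambda>f. 0 - ?c f) = coboundary p ?X b" by (auto simp: coboundaries_def)
    have "?c = coboundary p ?X (\<lambda>f. - b f)"
    proof
      fix f
      have "- ?c f = coboundary p ?X b f" using fun_cong[OF b, of f] by simp
      then show "?c f = coboundary p ?X (\<lambda>f. - b f) f"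
        by (simp add: coboundary_def sum_negf split: if_splits)
    qed
    then show False using not_coboundary by blast
  qed
  moreover have "foldr sym_diff (map (\<lambda>(d, \<omega>, A). \<omega>) ts) {} = {..<m}"
  proof -
    have "map (\<lambda>(d, \<omega>, A). \<omega>) ts = map (\<lambda>k. {j \<in> {..<m}. g j = k}) ks" by (simp add: ts_def \<omega>_def)
    then show ?thesis using foldr_sym_diff_partition[OF ks(1), of "{..<m}" g] g(1) ks(2) by auto
  qed
  moreover have "\<forall>(d, \<omega>, A) \<in> set ts. d \<in> {1, 2} \<and> \<omega> \<subseteq> {..<m} \<and> A \<in> graded_cohomology m K d \<omega>"
  proof -
    have "?cls k \<in> graded_cohomology m K 1 (\<omega> k)" if "k \<in> \<sigma>" for k
      using split_vertex_set.loop_class_graded[OF split[OF that]] \<omega>[OF that] by (simp add: a_def)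
    moreover have "\<omega> k \<subseteq> {..<m}" for k by (auto simp: \<omega>_def)
    ultimately show ?thesis using ks(2) by (auto simp: ts_def)
  qed
  ultimately show ?thesis unfolding almost_c_symplectic_def by blast
qed

context labelled_simplicial_polytope
begin

text \<open>Flagness enters through the existence of \<open>g\<close>: adding a further vertex to a facet does not give a face, so some
  pair in the enlarged set is not an edge.  Since the facet is a face, that pair contains the
  new vertex.\<close>

lemma flag_imp_almost_c_symplectic:
  assumes flag: "flag_complex K"
  shows "almost_c_symplectic m K"
proof -
  obtain \<sigma> where \<sigma>: "\<sigma> \<in> K" "card \<sigma> = n" using facet_exists by blast
  obtain \<epsilon> :: "nat set \<Rightarrow> rat" where \<epsilon>: "\<epsilon> \<sigma> \<noteq> 0"
    "\<And>\<rho>. finite \<rho> \<Longrightarrow> Suc (card \<rho>) = n \<Longrightarrow>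
      (\<Sum>i\<in>{i. i \<notin> \<rho> \<and> insert i \<rho> \<in> K}. (-1) ^ card {j \<in> \<rho>. j < i} * \<epsilon> (insert i \<rho>)) = 0"
    using fundamental_cycle[OF \<sigma>] by blast
  have vertex: "\<exists>\<tau>\<in>K. j \<in> \<tau>" if j: "j < m" for j
  proof -
    have "{v j} face_of P" using j extreme_points_eq face_of_singleton by blast
    moreover have "{v j} \<noteq> P" using aff_dim_eq dim_pos aff_dim_sing[of "v j"] by auto
    ultimately have "{j} \<in> K" using j by (simp add: boundary_complex_def)
    then show ?thesis by blast
  qed
  have "\<exists>k\<in>\<sigma>. \<forall>\<tau>\<in>K. j \<in> \<tau> \<longrightarrow> k \<notin> \<tau>" if j: "j < m" "j \<notin> \<sigma>" for j
  proof -
    have "insert j \<sigma> \<notin> K"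
      using card_simplex_le[of "insert j \<sigma>"] \<sigma> j(2) finite_simplex[OF \<sigma>(1)] by auto
    moreover have "insert j \<sigma> \<subseteq> \<Union>K" using vertex[OF j(1)] \<sigma>(1) by auto
    ultimately obtain J where J: "J \<subseteq> insert j \<sigma>" "J \<notin> K" "card J = 2"
      using flag unfolding flag_complex_def by blast
    have "j \<in> J" using J simplex_subsets[OF \<sigma>(1)] by blast
    then obtain k where k: "J = {j, k}" "k \<noteq> j" using J(3) by (auto simp: card_2_iff)
    then have "k \<in> \<sigma>" using J(1) by auto
    moreover have "k \<notin> \<tau>" if "\<tau> \<in> K" "j \<in> \<tau>" for \<tau>
      using simplex_subsets[OF that(1), of J] J(2) k that(2) by auto
    ultimately show ?thesis by blast
  qed
  then obtain h where h: "\<And>j. j < m \<Longrightarrow> j \<notin> \<sigma> \<Longrightarrow> h j \<in> \<sigma>"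
    "\<And>j \<tau>. j < m \<Longrightarrow> j \<notin> \<sigma> \<Longrightarrow> \<tau> \<in> K \<Longrightarrow> j \<in> \<tau> \<Longrightarrow> h j \<notin> \<tau>"
    by metis
  define g where "g j = (if j \<in> \<sigma> then j else h j)" for j
  show ?thesis
  proof (rule almost_c_symplectic_if_retraction[where \<sigma> = \<sigma> and p = "n - 1" and g = g and \<epsilon> = \<epsilon>])
    show "K \<subseteq> Pow {..<m}" using simplex_subset by blast
    show "card \<sigma> = Suc (n - 1)" using \<sigma>(2) dim_pos by simp
    show "{k} \<in> K" if "k \<in> \<sigma>" for k using simplex_subsets[OF \<sigma>(1)] that by blast
    show "g j \<in> \<sigma>" if "j < m" for j using h(1) that by (simp add: g_def)
    show "g j \<notin> \<tau>" if "\<tau> \<in> K" "j \<in> \<tau>" "j \<notin> \<sigma>" for \<tau> j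
    proof -
      have "j < m" using simplex_subset[OF that(1)] that(2) by auto
      then show ?thesis using h(2) that by (simp add: g_def)
    qed
    show "(\<Sum>i\<in>{i. i \<notin> \<rho> \<and> insert i \<rho> \<in> K}. (-1) ^ card {j \<in> \<rho>. j < i} * \<epsilon> (insert i \<rho>)) = 0"
      if "finite \<rho>" "card \<rho> = n - 1" for \<rho>
      using \<epsilon>(2)[OF that(1)] that(2) dim_pos by simp
  qed (use \<sigma> \<epsilon> g_def in auto)
qed

end

theorem proposition4p14:
  fixes P :: "'a::euclidean_space set" and v :: "nat \<Rightarrow> 'a" and m :: nat and K :: "nat set set"
  assumes "simplicial_polytope P"
    and "aff_dim P \<ge> 1"
    and "bij_betw v {..<m} {x. x extreme_point_of P}"
    and "K = boundary_complex m v P"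
    and "flag_complex K"
  shows "almost_c_symplectic m K"
proof -
  interpret labelled_simplicial_polytope P v m "nat (aff_dim P)"
    using assms by unfold_locales auto
  show ?thesis using flag_imp_almost_c_symplectic assms(4,5) by simp
qed

end
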